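(* Let $G=(V_P\cup V_L,E)$ be a point-line graph with $|V_L|\ge2$ and let $a_i\in\mathbb{S}^1$ for each $i\in V_L$, with the $a_i$ pairwise distinct. Then $G$ can be realised as a minimally infinitesimally fixed-intercept rigid line-concurrent framework such that each $i\in V_L$ is realised as the line with normal $a_i$ if and only if $|E|=2|V_P|+|V_L|-1$ and $$|F|\le2\nu_{V_P}(F)+\nu_{V_L}(F)-3+\min\{2,|V_L(F)|\}$$ for all nonempty $F\subseteq E$.
   Context: A point-line graph has vertex set partitioned into $V_P$ (points) and $V_L$ (lines), edges split into $E_{PP},E_{PL},E_{LL}$ by endpoint types. $V_L(F)$ is the set of vertices of $V_L$ incident to edges of $F$, and $\nu_Y(F)$ the number of vertices of $Y$ incident to edges of $F$. A line-concurrent framework is a point-line framework in $\mathbb{R}^2$ with points $p:V_P\to\mathbb{R}^2$ and lines $\{x:\langle x,a_j\rangle=0\}$, $a_j\in\mathbb{S}^1$, all passing through the origin. Its infinitesimal motions are the solutions $(\dot p,\dot a)$, $\dot p:V_P\to\mathbb{R}^2$, $\dot a:V_L\to\mathbb{R}^2$, of $\langle p_i-p_j,\dot p_i-\dot p_j\rangle=0$ ($ij\in E_{PP}$), $\langle p_i,\dot a_j\rangle+\langle\dot p_i,a_j\rangle=0$ ($ij\in E_{PL}$, $i\in V_P,j\in V_L$), $\langle a_i,\dot a_j\rangle+\langle\dot a_i,a_j\rangle=0$ ($ij\in E_{LL}$), $\langle a_i,\dot a_i\rangle=0$ ($i\in V_L$). It is infinitesimally fixed-intercept rigid if the only solutions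 are the trivial ones, namely the infinitesimal rotations about the origin (a one-dimensional space); it is minimally so if moreover deleting any edge destroys this property.
   Formalization: "a_i pairwise distinct" is read as the lines with normals a_i being pairwise distinct (a_i ≠ ±a_j); with only distinct vectors the claim fails, e.g. no points, two lines joined by one edge, a_2 = −a_1. *)

theory Defs
  imports "HOL-Analysis.Analysis"
begin

text \<open>
  A point-line graph is a finite simple graph; edges are two-element subsets of the disjoint
  union of \<open>VP\<close> (points) and \<open>VL\<close> (lines). The values of \<open>p\<close>, \<open>a\<close> and of their velocities
  outside \<open>VP\<close>, respectively \<open>VL\<close>, are never used.
\<close>

definition point_line_graph :: "'v set \<Rightarrow> 'v set \<Rightarrow> 'v set set \<Rightarrow> bool" where
  "point_line_graph VP VL E \<longleftrightarrow>
     finite VP \<and> finite VL \<and> VP \<inter> VL = {} \<and>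
     (\<forall>e\<in>E. \<exists>u\<in>VP \<union> VL. \<exists>v\<in>VP \<union> VL. u \<noteq> v \<and> e = {u, v})"

definition incident_vertices :: "'v set \<Rightarrow> 'v set set \<Rightarrow> 'v set" where
  "incident_vertices Y F = {v \<in> Y. \<exists>e\<in>F. v \<in> e}"

definition nu :: "'v set \<Rightarrow> 'v set set \<Rightarrow> nat" where
  "nu Y F = card (incident_vertices Y F)"

definition origin_line :: "real^2 \<Rightarrow> (real^2) set" where
  "origin_line n = {x. x \<bullet> n = 0}"

text \<open>
  The line vertex \<open>j\<close> is realised as \<open>origin_line (a j)\<close>; opposite normals give the same
  line, so distinctness of lines is stated for \<open>origin_line\<close>, not for \<open>a\<close>. Points need not be distinct,
  and an edge between a point and a line does not mean incidence.
\<close>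

definition line_concurrent_framework ::
  "'v set \<Rightarrow> 'v set \<Rightarrow> 'v set set \<Rightarrow> ('v \<Rightarrow> real^2) \<Rightarrow> ('v \<Rightarrow> real^2) \<Rightarrow> bool" where
  "line_concurrent_framework VP VL E p a \<longleftrightarrow>
     point_line_graph VP VL E \<and> (\<forall>j\<in>VL. norm (a j) = 1)"

definition infinitesimal_motion ::
  "'v set \<Rightarrow> 'v set \<Rightarrow> 'v set set \<Rightarrow> ('v \<Rightarrow> real^2) \<Rightarrow> ('v \<Rightarrow> real^2) \<Rightarrow>
     ('v \<Rightarrow> real^2) \<Rightarrow> ('v \<Rightarrow> real^2) \<Rightarrow> bool" where
  "infinitesimal_motion VP VL E p a dp da \<longleftrightarrow>
     (\<forall>i\<in>VP. \<forall>j\<in>VP. {i, j} \<in> E \<longrightarrow> (p i - p j) \<bullet> (dp i - dp j) = 0) \<and>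
     (\<forall>i\<in>VP. \<forall>j\<in>VL. {i, j} \<in> E \<longrightarrow> p i \<bullet> da j + dp i \<bullet> a j = 0) \<and>
     (\<forall>i\<in>VL. \<forall>j\<in>VL. {i, j} \<in> E \<longrightarrow> a i \<bullet> da j + da i \<bullet> a j = 0) \<and>
     (\<forall>i\<in>VL. a i \<bullet> da i = 0)"

definition rot90 :: "real^2 \<Rightarrow> real^2" where
  "rot90 x = vector [- (x $ 2), x $ 1]"

text \<open>
  \<open>rot90\<close> generates the rotations about the origin; these rotate the points and the line
  normals simultaneously, with a common angular velocity \<open>t\<close>.
\<close>

definition infinitesimal_rotation ::
  "'v set \<Rightarrow> 'v set \<Rightarrow> ('v \<Rightarrow> real^2) \<Rightarrow> ('v \<Rightarrow> real^2) \<Rightarrow>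
     ('v \<Rightarrow> real^2) \<Rightarrow> ('v \<Rightarrow> real^2) \<Rightarrow> bool" where
  "infinitesimal_rotation VP VL p a dp da \<longleftrightarrow>
     (\<exists>t::real. (\<forall>i\<in>VP. dp i = t *\<^sub>R rot90 (p i)) \<and> (\<forall>j\<in>VL. da j = t *\<^sub>R rot90 (a j)))"

definition inf_fixed_intercept_rigid ::
  "'v set \<Rightarrow> 'v set \<Rightarrow> 'v set set \<Rightarrow> ('v \<Rightarrow> real^2) \<Rightarrow> ('v \<Rightarrow> real^2) \<Rightarrow> bool" where
  "inf_fixed_intercept_rigid VP VL E p a \<longleftrightarrow>
     (\<forall>dp da. infinitesimal_motion VP VL E p a dp da \<longrightarrow> infinitesimal_rotation VP VL p a dp da)"

definition min_inf_fixed_intercept_rigid ::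
  "'v set \<Rightarrow> 'v set \<Rightarrow> 'v set set \<Rightarrow> ('v \<Rightarrow> real^2) \<Rightarrow> ('v \<Rightarrow> real^2) \<Rightarrow> bool" where
  "min_inf_fixed_intercept_rigid VP VL E p a \<longleftrightarrow>
     inf_fixed_intercept_rigid VP VL E p a \<and>
     (\<forall>e\<in>E. \<not> inf_fixed_intercept_rigid VP VL (E - {e}) p a)"

end

theory Submission
  imports Defs "HOL-Analysis.Finite_Function_Topology"
begin

text \<open>
  Each edge spans a subspace of possible rows of the rigidity matrix (dimension 2): for a point-point edge the
  direction is free, for a point-line or line-line edge the ratio of the two entries is free. The
  sparsity condition implies that the subspaces of a nonempty edge set \<open>F\<close> together have rank at least
  \<open>card F + 1\<close>. As in Lovasz's treatment of Dilworth truncation, one can then choose one row per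
  edge so that the rows are independent and their span avoids finitely many given nonzero vectors.
  A generic vector \<open>(p, s)\<close> orthogonal to all chosen rows has \<open>s j \<noteq> 0\<close> for all lines and distinct
  end points for all point-point edges; after rescaling the line columns by \<open>s\<close>, the chosen rows are
  precisely the rigidity matrix of the framework \<open>p\<close>. Conversely, minimal rigidity makes the rows
  independent, and the dilation and the admissible translations bound their number.
\<close>

section \<open>Generic selection of vectors\<close>

text \<open>The bound \<open>card F + 1\<close>, rather than \<open>card F\<close>, comes from the
  kernel vector: all rows of a framework annihilate the configuration that encodes its rotation, so
  an edge may use only the part of its space inside one common hyperplane, and cutting with a
  generic hyperplane costs one unit of rank. The rotation is encoded by \<open>(p, 1)\<close>, whose
  line part is not generic, while a generic kernel vector has some line part \<open>s\<close>.
  Leaving the ratios of entries free absorbs \<open>s\<close>; what remains of the prescribed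
  normals is that the point entry of a point-line row has the direction of the line. Two distinct
  lines have directions that span the plane, whence the minimum with 2. The constant 3 counts the
  independent functionals that annihilate all rows when no line is present, namely the rotation and
  two translations. One line leaves only the translation along it, two lines leave none, so the
  count drops to 2 and then to 1.\<close>

lemma subspace_avoid:
  fixes U :: "'a::real_vector set"
  assumes "finite \<T>" "subspace U"
    and "\<And>T. T \<in> \<T> \<Longrightarrow> subspace T \<and> \<not> U \<subseteq> T"
  shows "\<exists>u\<in>U. \<forall>T\<in>\<T>. u \<notin> T"
  using assms(1,3)
proof (induction \<T>)
  case empty
  then show ?case using \<open>subspace U\<close> subspace_0 by blast
next
  case (insert T \<T>)
  then obtain v where v: "v \<in> U" "\<forall>T\<in>\<T>. v \<notin> T" by blast
  obtain w where w: "w \<in> U" "w \<notin> T" using insert.prems by blast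
  show ?case
  proof (cases "v \<in> T")
    case False
    with v show ?thesis by blast
  next
    case True
    \<comment> \<open>The points \<open>w + t *\<^sub>R v\<close> all lie in \<open>U\<close> and
      all miss \<open>T\<close>, as \<open>v\<close> is in \<open>T\<close> and \<open>w\<close> is
      not. Any other \<open>T'\<close> contains at most one of them, since two would put
      \<open>v\<close> into \<open>T'\<close>; infinitely many parameters remain.\<close>
    have "finite {t. w + t *\<^sub>R v \<in> T'}" if "T' \<in> \<T>" for T'
    proof -
      have T': "subspace T'" "v \<notin> T'" using that v insert.prems by auto
      have "s = t" if "w + s *\<^sub>R v \<in> T'" "w + t *\<^sub>R v \<in> T'" for s t
      proof (rule ccontr)
        assume "s \<noteq> t"
        have "(s - t) *\<^sub>R v \<in> T'"
          using subspace_diff[OF T'(1) that] by (simp add: scaleR_diff_left)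
        then have "(1 / (s - t)) *\<^sub>R ((s - t) *\<^sub>R v) \<in> T'"
          using subspace_scale[OF T'(1)] by blast
        with \<open>s \<noteq> t\<close> T'(2) show False by simp
      qed
      then have "\<exists>s. {t. w + t *\<^sub>R v \<in> T'} \<subseteq> {s}" by blast
      then show ?thesis using finite_subset by blast
    qed
    then have "finite (\<Union>T'\<in>\<T>. {t. w + t *\<^sub>R v \<in> T'})" using insert.hyps by blast
    then obtain t where t: "t \<notin> (\<Union>T'\<in>\<T>. {t. w + t *\<^sub>R v \<in> T'})"
      using ex_new_if_finite infinite_UNIV_char_0 by blast
    have "w + t *\<^sub>R v \<notin> T"
      using True w insert.prems
      by (metis add_diff_cancel_right' insertI1 subspace_diff subspace_scale)
    moreover have "w + t *\<^sub>R v \<in> U"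
      using \<open>subspace U\<close> v w by (simp add: subspace_add subspace_scale)
    ultimately show ?thesis using t by blast
  qed
qed

text \<open>Phrased by an independent set inside the span, so that it makes sense without assuming
  that \<open>S\<close> spans a finite-dimensional space, and is monotone in the span.\<close>

definition rank_ge :: "nat \<Rightarrow> 'a::real_vector set \<Rightarrow> bool" where
  "rank_ge n S \<longleftrightarrow> (\<exists>B \<subseteq> span S. finite B \<and> independent B \<and> card B = n)"

lemma rank_ge_mono: "rank_ge n S \<Longrightarrow> S \<subseteq> span T \<Longrightarrow> rank_ge n T"
  unfolding rank_ge_def using span_minimal[of S "span T"] subspace_span by blast

lemma rank_ge_le: "rank_ge n S \<Longrightarrow> m \<le> n \<Longrightarrow> rank_ge m S"
  unfolding rank_ge_def
proof (elim exE conjE)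
  fix B assume B: "B \<subseteq> span S" "finite B" "independent B" "card B = n" and "m \<le> n"
  then obtain B' where "B' \<subseteq> B" "card B' = m" using obtain_subset_with_card_n by metis
  then show "\<exists>B\<subseteq>span S. finite B \<and> independent B \<and> card B = m"
    using B independent_mono finite_subset by (intro exI[of _ B']) auto
qed

lemma rank_ge_insert:
  assumes "rank_ge n S" "u \<notin> span S"
  shows "rank_ge (Suc n) (insert u S)"
proof -
  obtain B where B: "B \<subseteq> span S" "finite B" "independent B" "card B = n"
    using assms(1) unfolding rank_ge_def by blast
  have "u \<notin> span B" using B(1) assms(2) span_minimal[OF B(1)] by auto
  then have "independent (insert u B)" "u \<notin> B"
    using B(3) by (auto simp: independent_insert span_base)
  moreover have "insert u B \<subseteq> span (insert u S)"
    using B(1) span_mono[of S "insert u S"] by (auto simp: span_base)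
  ultimately show ?thesis unfolding rank_ge_def using B by (intro exI[of _ "insert u B"]) auto
qed

lemma rank_ge_card_le: "rank_ge n S \<Longrightarrow> finite S \<Longrightarrow> n \<le> card S"
  unfolding rank_ge_def using independent_span_bound by blast

lemma rank_ge_card_independent:
  assumes "rank_ge (card S) S" "finite S"
  shows "independent S"
proof (rule ccontr)
  assume "\<not> independent S"
  then obtain x where x: "x \<in> S" "x \<in> span (S - {x})" by (auto simp: dependent_def)
  then have "S \<subseteq> span (S - {x})" by (metis insert_Diff insert_subset span_superset)
  then have "rank_ge (card S) (S - {x})" using assms rank_ge_mono by blast
  then have "card S \<le> card (S - {x})" using rank_ge_card_le assms by blast
  then show False using card_Diff1_less[OF assms(2) x(1)] by linarith
qed

text \<open>\<open>U e\<close> can be shrunk to the line through any vector of \<open>U e\<close> that lies outside finitely many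
  subspaces, namely the spans whose rank would no longer increase.\<close>
lemma generic_selection_step:
  fixes U :: "'e \<Rightarrow> 'a::real_vector set"
  assumes fin: "finite E" "finite X" and "e \<in> E" "subspace (U e)"
    and rank: "\<And>x F. x \<in> X \<Longrightarrow> F \<subseteq> E \<Longrightarrow> rank_ge (card F + 1) (insert x (\<Union>(U ` F)))"
  shows "\<exists>u\<in>U e. \<forall>x\<in>X. \<forall>F. F \<subseteq> E \<longrightarrow>
    rank_ge (card F + 1) (insert x (\<Union>((U(e := {u})) ` F)))"
proof -
  define T where "T x F = span (insert x (\<Union>(U ` F)))" for x F
  \<comment> \<open>A span that contains all of \<open>U e\<close> cannot be avoided by
    \<open>u\<close>; it is also harmless, because over it \<open>U e\<close> contributes no
    rank.\<close>
  define \<T> where "\<T> = {T x F |x F. x \<in> X \<and> F \<subseteq> E \<and> \<not> U e \<subseteq> T x F}"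
  have "\<T> \<subseteq> (\<lambda>(x, F). T x F) ` (X \<times> Pow E)" unfolding \<T>_def by auto
  then have "finite \<T>" using fin finite_subset by blast
  moreover have "\<And>S. S \<in> \<T> \<Longrightarrow> subspace S \<and> \<not> U e \<subseteq> S"
    unfolding \<T>_def T_def by (auto simp: subspace_span)
  ultimately obtain u where u: "u \<in> U e" "\<forall>S\<in>\<T>. u \<notin> S"
    using subspace_avoid[of \<T> "U e"] \<open>subspace (U e)\<close> by blast
  show ?thesis
  proof (intro bexI[OF _ u(1)] ballI allI impI)
    fix x F assume x: "x \<in> X" and F: "F \<subseteq> E"
    define F' where "F' = F - {e}"
    have U': "\<Union>((U(e := {u})) ` F') = \<Union>(U ` F')" by (auto simp: F'_def)
    show "rank_ge (card F + 1) (insert x (\<Union>((U(e := {u})) ` F)))"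
    proof (cases "e \<in> F")
      case False
      then have "F' = F" by (auto simp: F'_def)
      then show ?thesis using U' rank[OF x F] by simp
    next
      case True
      have "finite F" using F fin(1) finite_subset by blast
      then have card: "card F = Suc (card F')" unfolding F'_def using True by (rule card.remove)
      have F': "F' \<subseteq> E" using F by (auto simp: F'_def)
      have *: "insert x (\<Union>((U(e := {u})) ` F)) = insert u (insert x (\<Union>(U ` F')))"
        using True by (auto simp: F'_def split: if_splits)
      \<comment> \<open>Either \<open>U e\<close> adds nothing over \<open>F'\<close>, and then
        \<open>F'\<close> alone already carries the rank demanded of \<open>F\<close>; or
        \<open>u\<close> was chosen outside the span over \<open>F'\<close> and raises its rank by
        one, exactly as \<open>card\<close> grows.\<close>
      show ?thesis
      proof (cases "U e \<subseteq> T x F'")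
        case True
        moreover have "insert x (\<Union>(U ` F)) \<subseteq> U e \<union> insert x (\<Union>(U ` F'))"
          unfolding F'_def by auto
        ultimately have "insert x (\<Union>(U ` F)) \<subseteq> span (insert x (\<Union>(U ` F')))"
          unfolding T_def using span_superset[of "insert x (\<Union>(U ` F'))"] by blast
        then show ?thesis unfolding *
          using rank[OF x F] rank_ge_mono span_mono
          by (meson order_trans subset_insertI)
      next
        case False
        then have "u \<notin> T x F'" using u x F' unfolding \<T>_def by blast
        then show ?thesis unfolding * using rank_ge_insert[OF rank[OF x F']] card
          by (simp add: T_def)
      qed
    qed
  qed
qed

text \<open>The invariant adjoins some \<open>x\<close> from \<open>X\<close> to every edge set and
  demands rank \<open>card F + 1\<close>. For nonempty \<open>F\<close> the hypothesis grants this
  without \<open>x\<close>, for empty \<open>F\<close> it only says that \<open>x\<close> is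
  nonzero. Once every \<open>U e\<close> has shrunk to one vector, the invariant for
  \<open>F = E\<close> leaves room for no coincidence: the chosen vectors are distinct, and together
  with \<open>x\<close> they are independent.\<close>

lemma generic_selection:
  fixes U :: "'e \<Rightarrow> 'a::real_vector set"
  assumes fin: "finite E" "finite X" and X: "X \<noteq> {}" "0 \<notin> X"
    and U: "\<And>e. e \<in> E \<Longrightarrow> subspace (U e)"
    and rank: "\<And>F. F \<subseteq> E \<Longrightarrow> F \<noteq> {} \<Longrightarrow> rank_ge (card F + 1) (\<Union>(U ` F))"
  shows "\<exists>u. (\<forall>e\<in>E. u e \<in> U e) \<and> inj_on u E \<and> independent (u ` E) \<and>
    (\<forall>x\<in>X. x \<notin> span (u ` E))"
proof -
  have base: "rank_ge (card F + 1) (insert x (\<Union>(U ` F)))" if "x \<in> X" "F \<subseteq> E" for x F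
  proof (cases "F = {}")
    case True
    have "x \<noteq> 0" using that X by blast
    then have "independent {x}" by simp
    then show ?thesis unfolding rank_ge_def using True by (intro exI[of _ "{x}"]) (auto simp: span_base)
  next
    case False
    then show ?thesis
      using rank[OF that(2)] rank_ge_mono span_superset by (metis subset_insertI subset_trans)
  qed
  have "\<exists>u. (\<forall>e\<in>D. u e \<in> U e) \<and> (\<forall>x\<in>X. \<forall>F. F \<subseteq> E \<longrightarrow>
           rank_ge (card F + 1) (insert x (\<Union>((\<lambda>e. if e \<in> D then {u e} else U e) ` F))))"
    if "finite D" "D \<subseteq> E" for D
    using that
  proof (induction D)
    case empty
    show ?case using base by auto
  next
    case (insert e D)
    then obtain u where u: "\<forall>e\<in>D. u e \<in> U e" and
      r: "\<forall>x\<in>X. \<forall>F. F \<subseteq> E \<longrightarrow>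
           rank_ge (card F + 1) (insert x (\<Union>((\<lambda>e. if e \<in> D then {u e} else U e) ` F)))"
      by auto
    let ?U = "\<lambda>e. if e \<in> D then {u e} else U e"
    have "e \<in> E" "subspace (?U e)" using insert U by auto
    moreover have "\<And>x F. x \<in> X \<Longrightarrow> F \<subseteq> E \<Longrightarrow> rank_ge (card F + 1) (insert x (\<Union>(?U ` F)))"
      using r by blast
    ultimately have "\<exists>v\<in>?U e. \<forall>x\<in>X. \<forall>F. F \<subseteq> E \<longrightarrow>
        rank_ge (card F + 1) (insert x (\<Union>((?U(e := {v})) ` F)))"
      by (rule generic_selection_step[OF fin])
    then obtain v where v: "v \<in> ?U e" "\<forall>x\<in>X. \<forall>F. F \<subseteq> E \<longrightarrow>
        rank_ge (card F + 1) (insert x (\<Union>((?U(e := {v})) ` F)))"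
      by blast
    have *: "?U(e := {v}) = (\<lambda>f. if f \<in> insert e D then {(u(e := v)) f} else U f)"
      using insert.hyps by (auto simp: fun_eq_iff)
    have "v \<in> U e" using v(1) insert.hyps by simp
    then have "\<forall>f\<in>insert e D. (u(e := v)) f \<in> U f" using u by simp
    moreover have "\<forall>x\<in>X. \<forall>F. F \<subseteq> E \<longrightarrow> rank_ge (card F + 1)
        (insert x (\<Union>((\<lambda>f. if f \<in> insert e D then {(u(e := v)) f} else U f) ` F)))"
      using v(2) unfolding * by blast
    ultimately show ?case by blast
  qed
  from this[OF fin(1) order_refl] obtain u where u: "\<forall>e\<in>E. u e \<in> U e"
    and r: "\<forall>x\<in>X. \<forall>F. F \<subseteq> E \<longrightarrow>
      rank_ge (card F + 1) (insert x (\<Union>((\<lambda>e. if e \<in> E then {u e} else U e) ` F)))"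
    by blast
  have r': "rank_ge (card E + 1) (insert x (u ` E))" if "x \<in> X" for x
  proof -
    have "\<Union>((\<lambda>e. if e \<in> E then {u e} else U e) ` E) = u ` E" by auto
    then show ?thesis using r that by (metis order_refl)
  qed
  have props: "inj_on u E \<and> independent (u ` E) \<and> x \<notin> span (u ` E)" if x: "x \<in> X" for x
  proof -
    have "card E + 1 \<le> card (insert x (u ` E))"
      using rank_ge_card_le[OF r'[OF x]] fin by simp
    then have *: "card (u ` E) = card E" "x \<notin> u ` E"
      using card_image_le[OF fin(1), of u] fin by (auto simp: card_insert_if split: if_splits)
    then have "independent (insert x (u ` E))"
      using r'[OF x] fin(1) by (intro rank_ge_card_independent) auto
    with * show ?thesis using fin(1) by (simp add: independent_insert eq_card_imp_inj_on)
  qed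
  show ?thesis using u props X by blast
qed

section \<open>Linear functionals and counting of independent vectors\<close>

text \<open>A functional on rows is a configuration in disguise. Vanishing on \<open>S\<close> will
  mean that the chosen rows annihilate the configuration, and being nonzero on \<open>X\<close> that
  the configuration is nondegenerate. The case of a single \<open>x\<close> tests membership in a
  span.\<close>

lemma functional_separating:
  fixes S :: "'a::real_vector set"
  assumes "finite X" "independent S" "\<And>x. x \<in> X \<Longrightarrow> x \<notin> span S"
  shows "\<exists>\<phi>::'a \<Rightarrow> real. linear \<phi> \<and> (\<forall>s\<in>S. \<phi> s = 0) \<and> (\<forall>x\<in>X. \<phi> x \<noteq> 0)"
  using assms(1,3)
proof (induction X)
  case empty
  show ?case by (intro exI[of _ "\<lambda>_. 0"]) (auto simp: linear_zero)
next
  case (insert x X)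
  then obtain \<phi> :: "'a \<Rightarrow> real" where \<phi>: "linear \<phi>" "\<forall>s\<in>S. \<phi> s = 0" "\<forall>x\<in>X. \<phi> x \<noteq> 0" by auto
  have "x \<notin> span S" using insert.prems by blast
  then have "x \<notin> S" "independent (insert x S)"
    using \<open>independent S\<close> by (auto simp: independent_insert intro: span_base)
  then obtain \<psi> :: "'a \<Rightarrow> real" where \<psi>: "linear \<psi>" "\<forall>s\<in>insert x S. \<psi> s = (if s = x then 1 else 0)"
    using linear_independent_extend[of "insert x S" "\<lambda>s. if s = x then 1 else 0::real"] by blast
  \<comment> \<open>The values of \<open>t\<close> at which \<open>\<phi> + t * \<psi>\<close> could
    vanish: \<open>- \<phi> x\<close> for \<open>x\<close> itself, where \<open>\<psi>\<close> is 1,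
    and the quotients for the old vectors. Where \<open>\<psi> y\<close> is 0 the quotient is 0 by
    convention, and the value at \<open>y\<close> stays \<open>\<phi> y\<close> for every
    \<open>t\<close>.\<close>
  have "finite (insert (- \<phi> x) ((\<lambda>y. - \<phi> y / \<psi> y) ` X \<union> {0}))" using insert by simp
  then obtain t where t: "t \<notin> insert (- \<phi> x) ((\<lambda>y. - \<phi> y / \<psi> y) ` X \<union> {0})"
    using ex_new_if_finite infinite_UNIV_char_0 by metis
  have "\<phi> y + t * \<psi> y \<noteq> 0" if "y \<in> insert x X" for y
  proof (cases "y = x")
    case True
    then show ?thesis using t \<psi> by auto
  next
    case False
    then have "y \<in> X" using that by simp
    then have "t \<noteq> - \<phi> y / \<psi> y" "\<phi> y \<noteq> 0" using t \<phi> by auto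
    then show ?thesis by (cases "\<psi> y = 0") (auto simp: field_simps)
  qed
  moreover have "linear (\<lambda>y. \<phi> y + t * \<psi> y)"
    using \<phi>(1) \<psi>(1) linear_compose_add linear_compose_scale_right[of \<psi> t] by auto
  moreover have "\<forall>s\<in>S. \<phi> s + t * \<psi> s = 0" using \<phi> \<psi> \<open>x \<notin> S\<close> by auto
  ultimately show ?case by blast
qed

text \<open>The rank of \<open>S\<close> is bounded from below by exhibiting few vectors
  \<open>C\<close> that complete \<open>S\<close> to a generating set of an independent set
  \<open>I\<close> of known size.\<close>

lemma card_le_card_complement:
  fixes S :: "'a::real_vector set"
  assumes "finite I" "independent I" "I \<subseteq> span (S \<union> C)" "finite C" "S \<subseteq> span I"
  obtains n where "rank_ge n S" "card I \<le> n + card C"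
proof -
  obtain B where B: "B \<subseteq> S" "independent B" "S \<subseteq> span B"
    using maximal_independent_subset by blast
  have fB: "finite B" using independent_span_bound[of I B] B assms by auto
  have "S \<union> C \<subseteq> span (B \<union> C)"
    using B(3) span_mono[of B "B \<union> C"] by (auto simp: span_base)
  then have "I \<subseteq> span (B \<union> C)" using assms(3) by (meson order_trans span_minimal subspace_span)
  then have "card I \<le> card (B \<union> C)" using independent_span_bound[of "B \<union> C" I] fB assms by auto
  then have "card I \<le> card B + card C" using card_Un_le order_trans by blast
  moreover have "rank_ge (card B) S"
    unfolding rank_ge_def using B fB by (intro exI[of _ B]) (auto simp: span_base)
  ultimately show thesis using that by blast
qed

lemma independent_card_eq_spans:
  fixes A :: "'a::real_vector set"
  assumes "finite A" "independent B" "B \<subseteq> span A" "card A \<le> card B"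
  shows "A \<subseteq> span B"
proof
  fix y assume "y \<in> A"
  show "y \<in> span B"
  proof (rule ccontr)
    assume y: "y \<notin> span B"
    have "finite B" using independent_span_bound assms by blast
    moreover have "independent (insert y B)" "y \<notin> B"
      using y assms by (auto simp: independent_insert span_base)
    moreover have "insert y B \<subseteq> span A" using \<open>y \<in> A\<close> assms by (auto simp: span_base)
    ultimately show False using independent_span_bound[of A "insert y B"] assms by auto
  qed
qed

lemma not_in_span_if_functional:
  fixes \<phi> :: "'a::real_vector \<Rightarrow> real"
  assumes "linear \<phi>" "\<And>s. s \<in> S \<Longrightarrow> \<phi> s = 0" "\<phi> x \<noteq> 0"
  shows "x \<notin> span S"
  using linear_eq_0_on_span[OF assms(1), of S x] assms by blast

text \<open>Each functional that annihilates the rows pays for one further independent vector.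
  Repeated use turns trivial motions into an upper bound on the number of rows.\<close>

lemma independent_insert_functional:
  fixes \<phi> :: "'a::real_vector \<Rightarrow> real"
  assumes "independent B" "linear \<phi>" "\<forall>y\<in>B. \<phi> y = 0" "\<phi> x \<noteq> 0"
  shows "independent (insert x B)" "x \<notin> B"
proof -
  have "x \<notin> span B" using not_in_span_if_functional[OF assms(2) _ assms(4)] assms(3) by simp
  then show "independent (insert x B)" using assms(1) by (rule independent_insertI)
  show "x \<notin> B" using assms(3,4) by auto
qed

lemma span_if_diff: "x - y \<in> span S \<Longrightarrow> y \<in> span S \<Longrightarrow> x \<in> span S"
  using span_add[of "x - y" S y] by simp

section \<open>Rows and configurations\<close>

lemma lookup_scaleR [simp]:
  "Poly_Mapping.lookup (c *\<^sub>R f) v = c *\<^sub>R Poly_Mapping.lookup (f :: 'v \<Rightarrow>\<^sub>0 'a::real_vector) v"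
proof -
  have "finite {i. c *\<^sub>R Poly_Mapping.lookup f i \<noteq> 0}"
    by (rule finite_subset[OF _ finite_lookup[of f]]) auto
  then show ?thesis by (simp add: scaleR_poly_mapping_def)
qed

lemma scaleR_single:
  "c *\<^sub>R Poly_Mapping.single v d = Poly_Mapping.single v (c *\<^sub>R (d::'a::real_vector))"
  by (rule poly_mapping_eqI) (simp add: lookup_single when_def)

lemma inner_real2: "x \<bullet> y = x $ 1 * y $ 1 + x $ 2 * y $ 2" for x y :: "real^2"
  by (simp add: inner_vec_def sum_2)

lemma eq_real2_iff: "x = y \<longleftrightarrow> x $ 1 = y $ 1 \<and> x $ 2 = y $ 2" for x y :: "real^2"
  by (simp add: vec_eq_iff forall_2)

lemma rot90_nth [simp]: "rot90 x $ 1 = - x $ 2" "rot90 x $ 2 = x $ 1"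
  by (simp_all add: rot90_def)

text \<open>In the plane the vectors orthogonal to \<open>d\<close> form a line, and
  \<open>x\<close> spans it. Both sides say that \<open>y\<close> is a multiple of \<open>x\<close>.
  Hence a point-point row whose direction \<open>d\<close> is orthogonal to \<open>p i - p j\<close>
  imposes the same condition as the true length constraint.\<close>

lemma orthogonal_rot90_iff:
  fixes x y d :: "real^2"
  assumes "x \<bullet> d = 0" "x \<noteq> 0" "d \<noteq> 0"
  shows "x \<bullet> rot90 y = 0 \<longleftrightarrow> y \<bullet> d = 0"
proof -
  have "(x \<bullet> rot90 y) * (d $ 1) = x $ 2 * (y \<bullet> d) - y $ 2 * (x \<bullet> d)"
    "(x \<bullet> rot90 y) * (d $ 2) = - (x $ 1) * (y \<bullet> d) + y $ 1 * (x \<bullet> d)"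
    by (simp_all add: inner_real2 algebra_simps)
  then have "(x \<bullet> rot90 y) * (d $ 1) = x $ 2 * (y \<bullet> d)"
    "(x \<bullet> rot90 y) * (d $ 2) = - (x $ 1) * (y \<bullet> d)"
    using assms(1) by simp_all
  moreover have "d $ 1 \<noteq> 0 \<or> d $ 2 \<noteq> 0" "x $ 1 \<noteq> 0 \<or> x $ 2 \<noteq> 0"
    using assms by (auto simp: eq_real2_iff)
  ultimately show ?thesis by (metis mult_eq_0_iff neg_equal_0_iff_equal)
qed

lemma scaleR_axis1: "c *\<^sub>R axis 1 x = (axis 1 (c * x) :: real^2)"
  and axis1_zero: "axis 1 0 = (0 :: real^2)"
  and add_axis1: "axis 1 x + axis 1 y = (axis 1 (x + y) :: real^2)"
  by (simp_all add: eq_real2_iff axis_def)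

lemma linear_single: "linear (\<lambda>d. Poly_Mapping.single i (d :: real^2))"
  by (rule linearI) (simp_all add: single_add scaleR_single)

text \<open>Rows of the rigidity matrix are finitely supported functions on the vertices. A line vertex has
  a single degree of freedom, so only the first coordinate of its entry is used.\<close>
definition unit_rows :: "'v set \<Rightarrow> 'v set \<Rightarrow> ('v \<Rightarrow>\<^sub>0 real^2) set" where
  "unit_rows P L = (\<lambda>(v, k). Poly_Mapping.single v (axis k 1)) ` (P \<times> UNIV \<union> L \<times> {1})"

lemma inj_unit_rows: "inj (\<lambda>(v, k). Poly_Mapping.single v (axis k (1::real)) :: 'v \<Rightarrow>\<^sub>0 real^2)"
proof (rule injI, clarify)
  fix v w :: 'v and k l :: 2
  assume eq: "Poly_Mapping.single v (axis k (1::real)) = Poly_Mapping.single w (axis l 1)"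
  have "Poly_Mapping.lookup (Poly_Mapping.single w (axis l (1::real))) v $ k = 1"
    by (simp add: eq[symmetric])
  then show "v = w \<and> k = l" by (auto simp: lookup_single when_def axis_def split: if_splits)
qed

lemma finite_unit_rows: "finite P \<Longrightarrow> finite L \<Longrightarrow> finite (unit_rows P L)"
  unfolding unit_rows_def by simp

lemma card_unit_rows:
  assumes "finite P" "finite L" "P \<inter> L = {}"
  shows "card (unit_rows P L) = 2 * card P + card L"
proof -
  have "card (unit_rows P L) = card (P \<times> (UNIV :: 2 set) \<union> L \<times> {1})"
    unfolding unit_rows_def by (rule card_image[OF inj_on_subset[OF inj_unit_rows]]) simp
  also have "\<dots> = card (P \<times> (UNIV :: 2 set)) + card (L \<times> {1 :: 2})"
    using assms by (intro card_Un_disjoint) auto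
  finally show ?thesis by (simp add: card_cartesian_product)
qed

lemma independent_unit_rows: "independent (unit_rows P L)"
  unfolding dependent_def
proof (rule notI, elim bexE)
  fix x assume x: "x \<in> unit_rows P L" "x \<in> span (unit_rows P L - {x})"
  then obtain v k where vk: "x = Poly_Mapping.single v (axis k 1)" unfolding unit_rows_def by auto
  let ?\<phi> = "\<lambda>f :: 'a \<Rightarrow>\<^sub>0 real^2. Poly_Mapping.lookup f v $ k"
  have "linear ?\<phi>" by (rule linearI) (auto simp: lookup_add)
  moreover have "?\<phi> y = 0" if "y \<in> unit_rows P L - {x}" for y
    using that unfolding unit_rows_def vk
    by (auto simp: lookup_single when_def axis_def)
  moreover have "?\<phi> x \<noteq> 0" by (simp add: vk)
  ultimately show False using not_in_span_if_functional x(2) by blast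
qed

lemma single_point_in_span:
  assumes "\<And>k. Poly_Mapping.single v (axis k (1::real)) \<in> span (S :: ('v \<Rightarrow>\<^sub>0 real^2) set)"
  shows "Poly_Mapping.single v d \<in> span S"
proof -
  have "d = (d $ 1) *\<^sub>R axis 1 1 + (d $ 2) *\<^sub>R axis 2 1"
    by (simp add: eq_real2_iff axis_def)
  then have "Poly_Mapping.single v d = (d $ 1) *\<^sub>R Poly_Mapping.single v (axis 1 1)
      + (d $ 2) *\<^sub>R Poly_Mapping.single v (axis 2 1)"
    by (metis scaleR_single single_add)
  then show ?thesis using assms by (metis span_add span_scale)
qed

lemma single_point_in_span_unit_rows:
  "i \<in> P \<Longrightarrow> Poly_Mapping.single i d \<in> span (unit_rows P L)"
  by (rule single_point_in_span, rule span_base) (auto simp: unit_rows_def)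

lemma single_line_in_span:
  assumes "Poly_Mapping.single j (axis 1 (1::real)) \<in> span (S :: ('v \<Rightarrow>\<^sub>0 real^2) set)"
  shows "Poly_Mapping.single j (axis 1 c) \<in> span S"
proof -
  have "c *\<^sub>R axis 1 1 = (axis 1 c :: real^2)" by (simp add: eq_real2_iff axis_def)
  then have "Poly_Mapping.single j (axis 1 c) = c *\<^sub>R Poly_Mapping.single j (axis 1 1 :: real^2)"
    by (simp add: scaleR_single)
  then show ?thesis using assms span_scale by metis
qed

lemma single_line_in_span_unit_rows:
  "j \<in> L \<Longrightarrow> Poly_Mapping.single j (axis 1 c) \<in> span (unit_rows P L)"
  by (rule single_line_in_span, rule span_base) (auto simp: unit_rows_def)

text \<open>The product of a row with a vector of velocities: two coordinates \<open>q i\<close> for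
  a point, one coordinate \<open>s j\<close> for a line. The same pairing serves for positions and
  for velocities.\<close>

definition config_pairing ::
  "'v set \<Rightarrow> 'v set \<Rightarrow> ('v \<Rightarrow> real^2) \<Rightarrow> ('v \<Rightarrow> real) \<Rightarrow> ('v \<Rightarrow>\<^sub>0 real^2) \<Rightarrow> real" where
  "config_pairing P L q s f =
     (\<Sum>i\<in>P. q i \<bullet> Poly_Mapping.lookup f i) + (\<Sum>j\<in>L. s j * Poly_Mapping.lookup f j $ 1)"

lemma linear_config_pairing: "linear (config_pairing P L q s)"
  by (rule linearI)
    (simp_all add: config_pairing_def lookup_add inner_add_right distrib_left sum.distrib
      sum_distrib_left mult.left_commute)

lemma config_pairing_point:
  assumes "finite P" "i \<in> P" "P \<inter> L = {}"
  shows "config_pairing P L q s (Poly_Mapping.single i d) = q i \<bullet> d"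
proof -
  have "(\<Sum>k\<in>P. q k \<bullet> Poly_Mapping.lookup (Poly_Mapping.single i d) k)
      = (\<Sum>k\<in>P. if k = i then q i \<bullet> d else 0)"
    by (rule sum.cong) (auto simp: lookup_single when_def)
  moreover have "(\<Sum>j\<in>L. s j * Poly_Mapping.lookup (Poly_Mapping.single i d) j $ 1) = 0"
    using assms by (intro sum.neutral) (auto simp: lookup_single when_def)
  ultimately show ?thesis using assms by (simp add: config_pairing_def)
qed

lemma config_pairing_line:
  assumes "finite L" "j \<in> L" "P \<inter> L = {}"
  shows "config_pairing P L q s (Poly_Mapping.single j d) = s j * d $ 1"
proof -
  have "(\<Sum>k\<in>L. s k * Poly_Mapping.lookup (Poly_Mapping.single j d) k $ 1)
      = (\<Sum>k\<in>L. if k = j then s j * d $ 1 else 0)"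
    by (rule sum.cong) (auto simp: lookup_single when_def)
  moreover have "(\<Sum>i\<in>P. q i \<bullet> Poly_Mapping.lookup (Poly_Mapping.single j d) i) = 0"
    using assms by (intro sum.neutral) (auto simp: lookup_single when_def)
  ultimately show ?thesis using assms by (simp add: config_pairing_def)
qed

text \<open>The values on the unit rows determine a functional on their span and are the coordinates
  of a configuration. In this way an abstract functional becomes positions of points or
  velocities.\<close>

lemma functional_eq_config_pairing:
  fixes \<phi> :: "('v \<Rightarrow>\<^sub>0 real^2) \<Rightarrow> real"
  assumes "linear \<phi>" "finite P" "finite L" "P \<inter> L = {}"
  shows "\<exists>q s. (\<forall>f\<in>span (unit_rows P L). \<phi> f = config_pairing P L q s f) \<and>
    (\<forall>j. s j = \<phi> (Poly_Mapping.single j (axis 1 1))) \<and>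
    (\<forall>i\<in>P. \<forall>d. q i \<bullet> d = \<phi> (Poly_Mapping.single i d))"
proof -
  define q where "q i = (\<chi> k. \<phi> (Poly_Mapping.single i (axis k 1)))" for i
  define s where "s j = \<phi> (Poly_Mapping.single j (axis 1 1))" for j
  have eq: "\<phi> f = config_pairing P L q s f" if f: "f \<in> span (unit_rows P L)" for f
  proof (rule linear_eq_on[OF assms(1) linear_config_pairing f])
    fix x assume "x \<in> unit_rows P L"
    then consider i k where "i \<in> P" "x = Poly_Mapping.single i (axis k 1)"
      | j where "j \<in> L" "x = Poly_Mapping.single j (axis 1 1)"
      unfolding unit_rows_def by auto
    then show "\<phi> x = config_pairing P L q s x"
      using assms by cases (simp_all add: config_pairing_point config_pairing_line q_def s_def inner_axis)
  qed
  show ?thesis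
  proof (intro exI conjI ballI allI)
    show "\<phi> f = config_pairing P L q s f" if "f \<in> span (unit_rows P L)" for f using eq that .
    show "s j = \<phi> (Poly_Mapping.single j (axis 1 1))" for j by (simp add: s_def)
    show "q i \<bullet> d = \<phi> (Poly_Mapping.single i d)" if "i \<in> P" for i d
      using eq[OF single_point_in_span_unit_rows[OF that]] assms that
      by (simp add: config_pairing_point)
  qed
qed

text \<open>The allowed deficit against the dimension \<open>2 * nu VP F + nu VL F\<close> of the
  row space is 3, 2 or 1, for no line, one line, or more lines. Integers keep the subtraction of 3
  exact.\<close>

definition sparse_count :: "'v set \<Rightarrow> 'v set \<Rightarrow> 'v set set \<Rightarrow> bool" where
  "sparse_count VP VL F \<longleftrightarrow> int (card F) \<le> 2 * int (nu VP F) + int (nu VL F) - 3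
     + min 2 (int (card (incident_vertices VL F)))"

section \<open>Concurrent lines\<close>

locale concurrent_lines =
  fixes VP VL :: "'v set" and E :: "'v set set" and a :: "'v \<Rightarrow> real^2"
  assumes graph: "point_line_graph VP VL E"
    and norm_a: "j \<in> VL \<Longrightarrow> norm (a j) = 1"
    and inj_lines: "inj_on (\<lambda>j. origin_line (a j)) VL"
begin

lemma fin: "finite VP" "finite VL" and disj: "VP \<inter> VL = {}"
  using graph unfolding point_line_graph_def by auto

lemma edge_ends:
  assumes "e \<in> E"
  obtains u v where "u \<in> VP \<union> VL" "v \<in> VP \<union> VL" "u \<noteq> v" "e = {u, v}"
proof -
  have "\<forall>e\<in>E. \<exists>u\<in>VP \<union> VL. \<exists>v\<in>VP \<union> VL. u \<noteq> v \<and> e = {u, v}"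
    using graph unfolding point_line_graph_def by (elim conjE)
  from bspec[OF this assms] show thesis using that by (elim bexE conjE)
qed

lemma edge_distinct: "{i, j} \<in> E \<Longrightarrow> i \<noteq> j"
proof -
  assume "{i, j} \<in> E"
  then obtain u v where "u \<noteq> v" "{i, j} = {u, v}"
    by (rule edge_ends)
  then show ?thesis by (auto simp: doubleton_eq_iff)
qed

lemma finite_E: "finite E"
proof -
  have "E \<subseteq> Pow (VP \<union> VL)" by (auto elim!: edge_ends)
  then show ?thesis using fin finite_subset by blast
qed

lemma edge_cases:
  assumes "e \<in> E"
  obtains (PP) i j where "i \<in> VP" "j \<in> VP" "i \<noteq> j" "e = {i, j}"
  | (PL) i j where "i \<in> VP" "j \<in> VL" "i \<noteq> j" "e = {i, j}"
  | (LL) i j where "i \<in> VL" "j \<in> VL" "i \<noteq> j" "e = {i, j}"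
proof -
  obtain u v where uv: "u \<in> VP \<union> VL" "v \<in> VP \<union> VL" "u \<noteq> v" "e = {u, v}"
    using assms by (rule edge_ends)
  have vu: "v \<noteq> u" "e = {v, u}" using uv by auto
  consider "u \<in> VP" "v \<in> VP" | "u \<in> VP" "v \<in> VL" | "v \<in> VP" "u \<in> VL" | "u \<in> VL" "v \<in> VL"
    using uv(1,2) by blast
  then show thesis
  proof cases
    case 1 then show ?thesis by (rule PP[OF _ _ uv(3,4)])
  next
    case 2 then show ?thesis by (rule PL[OF _ _ uv(3,4)])
  next
    case 3 then show ?thesis by (rule PL[OF _ _ vu])
  next
    case 4 then show ?thesis by (rule LL[OF _ _ uv(3,4)])
  qed
qed

section \<open>Directions of the lines\<close>

text \<open>The direction of the line \<open>j\<close>. After velocities are turned by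
  \<open>rot90\<close>, a point-line constraint sees a point only through its component along
  \<open>b j\<close>.\<close>

abbreviation b :: "'v \<Rightarrow> real^2" where "b j \<equiv> rot90 (a j)"

lemma inner_a: "j \<in> VL \<Longrightarrow> a j \<bullet> a j = 1"
  using norm_a by (simp add: dot_square_norm)

text \<open>Up to sign this inner product is the determinant of the two normals. It vanishes only
  for parallel normals, that is, for equal lines; this is where distinctness of the lines
  enters.\<close>

lemma cross_nonzero:
  assumes "i \<in> VL" "j \<in> VL" "i \<noteq> j"
  shows "a i \<bullet> b j \<noteq> 0"
proof
  assume "a i \<bullet> b j = 0"
  then have c: "a i $ 2 * a j $ 1 = a i $ 1 * a j $ 2" by (simp add: inner_real2)
  \<comment> \<open>The last condition says that \<open>y\<close> and \<open>z\<close> are parallel.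
    Stated for arbitrary vectors, it yields both inclusions between the two lines.\<close>
  have *: "x \<bullet> y = 0" if "y \<bullet> y = 1" "z \<bullet> z = 1" "x \<bullet> z = 0" "z $ 2 * y $ 1 = z $ 1 * y $ 2"
    for x y z :: "real^2"
  proof -
    have "z $ 1 * (x \<bullet> y) = y $ 1 * (x \<bullet> z)" "z $ 2 * (x \<bullet> y) = y $ 2 * (x \<bullet> z)"
      using that(4) unfolding inner_real2 by algebra+
    moreover have "z $ 1 \<noteq> 0 \<or> z $ 2 \<noteq> 0" using that(2) by (auto simp: inner_real2)
    ultimately show ?thesis using that(3) by auto
  qed
  have "origin_line (a i) = origin_line (a j)"
    unfolding origin_line_def
  proof (intro Collect_cong iffI)
    fix x
    show "x \<bullet> a j = 0" if "x \<bullet> a i = 0"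
      by (rule *[OF inner_a[OF assms(2)] inner_a[OF assms(1)] that c])
    have "a j $ 2 * a i $ 1 = a j $ 1 * a i $ 2" using c by (simp only: mult.commute)
    then show "x \<bullet> a i = 0" if "x \<bullet> a j = 0"
      by (rule *[OF inner_a[OF assms(1)] inner_a[OF assms(2)] that])
  qed
  then show False using inj_lines assms by (auto dest: inj_onD)
qed

lemma b_spans:
  assumes "i \<in> VL" "j \<in> VL" "i \<noteq> j"
  obtains \<alpha> \<beta> where "d = \<alpha> *\<^sub>R b i + \<beta> *\<^sub>R b j"
proof -
  define D where "D = a i \<bullet> b j"
  have "D \<noteq> 0" using cross_nonzero assms by (simp add: D_def)
  \<comment> \<open>Pairing with \<open>a j\<close> annihilates \<open>b j\<close>, pairing with
    \<open>a i\<close> annihilates \<open>b i\<close>. The sign appears because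
    \<open>b i \<bullet> a j\<close> equals \<open>- D\<close>.\<close>
  have "d = (d \<bullet> a j / - D) *\<^sub>R b i + (d \<bullet> a i / D) *\<^sub>R b j"
    using \<open>D \<noteq> 0\<close> by (simp add: eq_real2_iff field_simps) (simp add: inner_real2 D_def algebra_simps)
  then show thesis using that by blast
qed

lemma orthonormal_expansion:
  assumes "j \<in> VL"
  shows "d = (d \<bullet> b j) *\<^sub>R b j + (d \<bullet> a j) *\<^sub>R a j"
proof -
  have n: "a j $ 1 * a j $ 1 + a j $ 2 * a j $ 2 = 1"
    using inner_a[OF assms] unfolding inner_real2 .
  have "d $ 1 = (d \<bullet> b j) * (b j $ 1) + (d \<bullet> a j) * (a j $ 1)"
    "d $ 2 = (d \<bullet> b j) * (b j $ 2) + (d \<bullet> a j) * (a j $ 2)"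
    using n unfolding inner_real2 rot90_nth by algebra+
  then show ?thesis unfolding eq_real2_iff by simp
qed

section \<open>Infinitesimal motions in rotated coordinates\<close>

text \<open>Velocities are written as \<open>dp = rot90 \<circ> q\<close> and \<open>da j = \<sigma> j *\<^sub>R rot90 (a j)\<close>; rotations then become
  the multiples of \<open>(p, 1)\<close>.\<close>
definition edge_ok :: "('v \<Rightarrow> real^2) \<Rightarrow> ('v \<Rightarrow> real^2) \<Rightarrow> ('v \<Rightarrow> real) \<Rightarrow> 'v set \<Rightarrow> bool" where
  "edge_ok p q \<sigma> e \<longleftrightarrow>
     (\<forall>i\<in>VP. \<forall>j\<in>VP. e = {i, j} \<longrightarrow> (p i - p j) \<bullet> rot90 (q i - q j) = 0) \<and>
     (\<forall>i\<in>VP. \<forall>j\<in>VL. e = {i, j} \<longrightarrow> q i \<bullet> b j = \<sigma> j * (p i \<bullet> b j)) \<and>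
     (\<forall>i\<in>VL. \<forall>j\<in>VL. e = {i, j} \<longrightarrow> \<sigma> i = \<sigma> j)"

lemma edge_ok_PP:
  assumes "i \<in> VP" "j \<in> VP"
  shows "edge_ok p q \<sigma> {i, j} \<longleftrightarrow> (p i - p j) \<bullet> rot90 (q i - q j) = 0"
proof -
  have "(p j - p i) \<bullet> rot90 (q j - q i) = (p i - p j) \<bullet> rot90 (q i - q j)"
    by (simp add: inner_real2 algebra_simps)
  moreover have "i \<notin> VL" "j \<notin> VL" using assms disj by auto
  ultimately show ?thesis using assms unfolding edge_ok_def by (auto simp: doubleton_eq_iff)
qed

lemma edge_ok_PL:
  "i \<in> VP \<Longrightarrow> j \<in> VL \<Longrightarrow> edge_ok p q \<sigma> {i, j} \<longleftrightarrow> q i \<bullet> b j = \<sigma> j * (p i \<bullet> b j)"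
proof -
  assume "i \<in> VP" "j \<in> VL"
  moreover from this have "i \<notin> VL" "j \<notin> VP" using disj by auto
  ultimately show ?thesis unfolding edge_ok_def by (auto simp: doubleton_eq_iff)
qed

lemma edge_ok_LL:
  "i \<in> VL \<Longrightarrow> j \<in> VL \<Longrightarrow> edge_ok p q \<sigma> {i, j} \<longleftrightarrow> \<sigma> i = \<sigma> j"
proof -
  assume "i \<in> VL" "j \<in> VL"
  moreover from this have "i \<notin> VP" "j \<notin> VP" using disj by auto
  ultimately show ?thesis unfolding edge_ok_def by (auto simp: doubleton_eq_iff)
qed

text \<open>The condition \<open>a i \<bullet> da i = 0\<close> holds by the form of
  \<open>da\<close>. A line-line constraint becomes \<open>\<sigma> j - \<sigma> i\<close> times the
  nonzero number \<open>a i \<bullet> b j\<close>, so it says that both lines turn at the same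
  speed, independently of their angle.\<close>

lemma motion_iff_edge_ok:
  assumes "E' \<subseteq> E"
    and dp: "\<And>i. i \<in> VP \<Longrightarrow> dp i = rot90 (q i)"
    and da: "\<And>j. j \<in> VL \<Longrightarrow> da j = \<sigma> j *\<^sub>R b j"
  shows "infinitesimal_motion VP VL E' p a dp da \<longleftrightarrow> (\<forall>e\<in>E'. edge_ok p q \<sigma> e)"
proof -
  have pp: "(p i - p j) \<bullet> (dp i - dp j) = (p i - p j) \<bullet> rot90 (q i - q j)"
    if "i \<in> VP" "j \<in> VP" for i j
    using that by (simp add: dp inner_real2)
  have pl: "p i \<bullet> da j + dp i \<bullet> a j = 0 \<longleftrightarrow> q i \<bullet> b j = \<sigma> j * (p i \<bullet> b j)"
    if "i \<in> VP" "j \<in> VL" for i j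
    using that by (auto simp: dp da inner_real2 algebra_simps)
  have ll: "a i \<bullet> da j + da i \<bullet> a j = 0 \<longleftrightarrow> \<sigma> i = \<sigma> j"
    if "i \<in> VL" "j \<in> VL" "{i, j} \<in> E'" for i j
  proof -
    have "a i \<bullet> da j + da i \<bullet> a j = (\<sigma> j - \<sigma> i) * (a i \<bullet> b j)"
      using that by (simp add: da inner_real2 algebra_simps)
    moreover have "a i \<bullet> b j \<noteq> 0" using cross_nonzero edge_distinct that assms(1) by blast
    ultimately show ?thesis by auto
  qed
  have aa: "a i \<bullet> da i = 0" if "i \<in> VL" for i
    using that by (simp add: da inner_real2)
  show ?thesis
  proof
    assume m: "infinitesimal_motion VP VL E' p a dp da"
    have mpp: "(p i - p j) \<bullet> (dp i - dp j) = 0" if "i \<in> VP" "j \<in> VP" "{i, j} \<in> E'" for i j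
      using m that unfolding infinitesimal_motion_def by simp
    have mpl: "p i \<bullet> da j + dp i \<bullet> a j = 0" if "i \<in> VP" "j \<in> VL" "{i, j} \<in> E'" for i j
      using m that unfolding infinitesimal_motion_def by simp
    have mll: "a i \<bullet> da j + da i \<bullet> a j = 0" if "i \<in> VL" "j \<in> VL" "{i, j} \<in> E'" for i j
      using m that unfolding infinitesimal_motion_def by simp
    show "\<forall>e\<in>E'. edge_ok p q \<sigma> e"
    proof
      fix e assume e: "e \<in> E'"
      then have "e \<in> E" using assms(1) by blast
      then show "edge_ok p q \<sigma> e"
      proof (cases rule: edge_cases)
        case (PP i j)
        then show ?thesis using mpp[of i j] pp[of i j] e edge_ok_PP[of i j] by simp
      next
        case (PL i j)
        then show ?thesis using mpl[of i j] pl[of i j] e edge_ok_PL[of i j] by simp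
      next
        case (LL i j)
        then show ?thesis using mll[of i j] ll[of i j] e edge_ok_LL[of i j] by simp
      qed
    qed
  next
    assume ok: "\<forall>e\<in>E'. edge_ok p q \<sigma> e"
    show "infinitesimal_motion VP VL E' p a dp da"
      unfolding infinitesimal_motion_def
    proof (intro conjI ballI impI)
      show "(p i - p j) \<bullet> (dp i - dp j) = 0" if "i \<in> VP" "j \<in> VP" "{i, j} \<in> E'" for i j
        using bspec[OF ok that(3)] pp[OF that(1,2)] edge_ok_PP[OF that(1,2)] by simp
      show "p i \<bullet> da j + dp i \<bullet> a j = 0" if "i \<in> VP" "j \<in> VL" "{i, j} \<in> E'" for i j
        using bspec[OF ok that(3)] pl[OF that(1,2)] edge_ok_PL[OF that(1,2)] by simp
      show "a i \<bullet> da j + da i \<bullet> a j = 0" if "i \<in> VL" "j \<in> VL" "{i, j} \<in> E'" for i j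
        using bspec[OF ok that(3)] ll[OF that] edge_ok_LL[OF that(1,2)] by simp
      show "a i \<bullet> da i = 0" if "i \<in> VL" for i using aa that .
    qed
  qed
qed

text \<open>No motion is lost by passing to \<open>q\<close> and \<open>\<sigma>\<close>:
  \<open>rot90\<close> is invertible with square minus the identity, which explains the sign in
  \<open>q i = - rot90 (dp i)\<close>, and the normalisation \<open>a j \<bullet> da j = 0\<close>
  leaves \<open>da j\<close> only its component along \<open>b j\<close>.\<close>

lemma rigid_iff:
  assumes "E' \<subseteq> E"
  shows "inf_fixed_intercept_rigid VP VL E' p a \<longleftrightarrow>
    (\<forall>q \<sigma>. (\<forall>e\<in>E'. edge_ok p q \<sigma> e) \<longrightarrow>
       (\<exists>t. (\<forall>i\<in>VP. q i = t *\<^sub>R p i) \<and> (\<forall>j\<in>VL. \<sigma> j = t)))"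
proof -
  have b0: "b j \<noteq> 0" if "j \<in> VL" for j
    using inner_a[OF that] by (auto simp: eq_real2_iff inner_real2)
  have rot: "infinitesimal_rotation VP VL p a dp da \<longleftrightarrow>
       (\<exists>t. (\<forall>i\<in>VP. q i = t *\<^sub>R p i) \<and> (\<forall>j\<in>VL. \<sigma> j = t))"
    if dpq: "\<And>i. i \<in> VP \<Longrightarrow> dp i = rot90 (q i)" and das: "\<And>j. j \<in> VL \<Longrightarrow> da j = \<sigma> j *\<^sub>R b j" for dp da q \<sigma>
  proof -
    have "dp i = t *\<^sub>R rot90 (p i) \<longleftrightarrow> q i = t *\<^sub>R p i" if "i \<in> VP" for i t
      unfolding dpq[OF that] eq_real2_iff by auto
    moreover have "da j = t *\<^sub>R b j \<longleftrightarrow> \<sigma> j = t" if "j \<in> VL" for j t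
      unfolding das[OF that] using b0[OF that] by simp
    ultimately show ?thesis unfolding infinitesimal_rotation_def by simp
  qed
  show ?thesis
  proof
    assume r: "inf_fixed_intercept_rigid VP VL E' p a"
    show "\<forall>q \<sigma>. (\<forall>e\<in>E'. edge_ok p q \<sigma> e) \<longrightarrow>
       (\<exists>t. (\<forall>i\<in>VP. q i = t *\<^sub>R p i) \<and> (\<forall>j\<in>VL. \<sigma> j = t))"
    proof (intro allI impI)
      fix q \<sigma> assume "\<forall>e\<in>E'. edge_ok p q \<sigma> e"
      then have "infinitesimal_motion VP VL E' p a (\<lambda>i. rot90 (q i)) (\<lambda>j. \<sigma> j *\<^sub>R b j)"
        using motion_iff_edge_ok[OF assms, of "\<lambda>i. rot90 (q i)" q "\<lambda>j. \<sigma> j *\<^sub>R b j" \<sigma> p] by simp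
      then have "infinitesimal_rotation VP VL p a (\<lambda>i. rot90 (q i)) (\<lambda>j. \<sigma> j *\<^sub>R b j)"
        using r unfolding inf_fixed_intercept_rigid_def by blast
      then show "\<exists>t. (\<forall>i\<in>VP. q i = t *\<^sub>R p i) \<and> (\<forall>j\<in>VL. \<sigma> j = t)"
        using rot[of "\<lambda>i. rot90 (q i)" q "\<lambda>j. \<sigma> j *\<^sub>R b j" \<sigma>] by simp
    qed
  next
    assume r: "\<forall>q \<sigma>. (\<forall>e\<in>E'. edge_ok p q \<sigma> e) \<longrightarrow>
       (\<exists>t. (\<forall>i\<in>VP. q i = t *\<^sub>R p i) \<and> (\<forall>j\<in>VL. \<sigma> j = t))"
    show "inf_fixed_intercept_rigid VP VL E' p a"
      unfolding inf_fixed_intercept_rigid_def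
    proof (intro allI impI)
      fix dp da assume m: "infinitesimal_motion VP VL E' p a dp da"
      define q where "q i = - rot90 (dp i)" for i
      define \<sigma> where "\<sigma> j = da j \<bullet> b j" for j
      have dp: "dp i = rot90 (q i)" for i by (simp add: q_def eq_real2_iff)
      have da: "da j = \<sigma> j *\<^sub>R b j" if "j \<in> VL" for j
      proof -
        have "a j \<bullet> da j = 0" using m that unfolding infinitesimal_motion_def by blast
        then show ?thesis
          using orthonormal_expansion[OF that, of "da j"] by (simp add: \<sigma>_def inner_commute)
      qed
      show "infinitesimal_rotation VP VL p a dp da"
        using r m motion_iff_edge_ok[of E' dp q da \<sigma> p, OF assms dp da] rot[of dp q da \<sigma>, OF dp da]
        by simp
    qed
  qed
qed

section \<open>Rows contributed by single edges\<close>

abbreviation cfg :: "('v \<Rightarrow> real^2) \<Rightarrow> ('v \<Rightarrow> real) \<Rightarrow> ('v \<Rightarrow>\<^sub>0 real^2) \<Rightarrow> real" where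
  "cfg \<equiv> config_pairing VP VL"

lemma cfg_point [simp]: "i \<in> VP \<Longrightarrow> cfg q s (Poly_Mapping.single i d) = q i \<bullet> d"
  by (rule config_pairing_point[OF fin(1) _ disj])

lemma cfg_line [simp]: "j \<in> VL \<Longrightarrow> cfg q s (Poly_Mapping.single j d) = s j * d $ 1"
  by (rule config_pairing_line[OF fin(2) _ disj])

lemma cfg_add [simp]: "cfg q s (f + g) = cfg q s f + cfg q s g"
  and cfg_diff [simp]: "cfg q s (f - g) = cfg q s f - cfg q s g"
  by (rule linear_add[OF linear_config_pairing] linear_diff[OF linear_config_pairing])+

text \<open>All rows that \<open>e\<close> can contribute to the rigidity matrix, over all positions of the points and all
  rescalings of the line columns.\<close>
definition edge_space :: "'v set \<Rightarrow> ('v \<Rightarrow>\<^sub>0 real^2) set" where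
  "edge_space e =
     (\<Union>i\<in>VP. \<Union>j\<in>{j \<in> VP. e = {i, j}}.
        range (\<lambda>d. Poly_Mapping.single i d - Poly_Mapping.single j d)) \<union>
     (\<Union>i\<in>VP. \<Union>j\<in>{j \<in> VL. e = {i, j}}.
        range (\<lambda>(\<alpha>, \<beta>). Poly_Mapping.single i (\<alpha> *\<^sub>R b j) + Poly_Mapping.single j (axis 1 \<beta>))) \<union>
     (\<Union>i\<in>VL. \<Union>j\<in>{j \<in> VL. e = {i, j}}.
        range (\<lambda>(\<alpha>, \<beta>). Poly_Mapping.single i (axis 1 \<alpha>) + Poly_Mapping.single j (axis 1 \<beta>)))"

lemma edge_space_PP:
  assumes "i \<in> VP" "j \<in> VP"
  shows "edge_space {i, j} = range (\<lambda>d. Poly_Mapping.single i d - Poly_Mapping.single j d)"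
    (is "_ = ?R")
proof
  have "Poly_Mapping.single j d - Poly_Mapping.single i d
      = Poly_Mapping.single i (- d) - Poly_Mapping.single j (- d)" for d :: "real^2"
    by (simp add: single_uminus)
  then have "Poly_Mapping.single j d - Poly_Mapping.single i d \<in> ?R" for d :: "real^2"
    by blast
  moreover have "i \<notin> VL" "j \<notin> VL" using assms disj by auto
  ultimately show "edge_space {i, j} \<subseteq> ?R"
    unfolding edge_space_def by (auto simp: doubleton_eq_iff)
  show "?R \<subseteq> edge_space {i, j}"
    unfolding edge_space_def
    by (rule subsetI, rule UnI1, rule UnI1, rule UN_I[OF assms(1)], rule UN_I[of j], rule CollectI,
        rule conjI[OF assms(2) refl])
qed

lemma edge_space_PL:
  assumes "i \<in> VP" "j \<in> VL"
  shows "edge_space {i, j} =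
    range (\<lambda>(\<alpha>, \<beta>). Poly_Mapping.single i (\<alpha> *\<^sub>R b j) + Poly_Mapping.single j (axis 1 \<beta>))"
    (is "_ = ?R")
proof
  have "i \<notin> VL" "j \<notin> VP" using assms disj by auto
  then show "edge_space {i, j} \<subseteq> ?R"
    unfolding edge_space_def by (auto simp: doubleton_eq_iff)
  show "?R \<subseteq> edge_space {i, j}"
    unfolding edge_space_def
    by (rule subsetI, rule UnI1, rule UnI2, rule UN_I[OF assms(1)], rule UN_I[of j], rule CollectI,
        rule conjI[OF assms(2) refl])
qed

lemma edge_space_LL:
  assumes "i \<in> VL" "j \<in> VL"
  shows "edge_space {i, j} =
    range (\<lambda>(\<alpha>, \<beta>). Poly_Mapping.single i (axis 1 \<alpha>) + Poly_Mapping.single j (axis 1 \<beta>))"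
    (is "_ = ?R")
proof
  have "i \<notin> VP" "j \<notin> VP" using assms disj by auto
  moreover have "Poly_Mapping.single j (axis 1 \<alpha>) + Poly_Mapping.single i (axis 1 \<beta>) \<in> ?R"
    for \<alpha> \<beta> :: real
    by (rule range_eqI[of _ _ "(\<beta>, \<alpha>)"]) (simp add: add.commute)
  ultimately show "edge_space {i, j} \<subseteq> ?R"
    unfolding edge_space_def by (auto simp: doubleton_eq_iff)
  show "?R \<subseteq> edge_space {i, j}"
    unfolding edge_space_def
    by (rule subsetI, rule UnI2, rule UN_I[OF assms(1)], rule UN_I[of j], rule CollectI,
        rule conjI[OF assms(2) refl])
qed

lemma subspace_edge_space:
  assumes "e \<in> E"
  shows "subspace (edge_space e)"
  using assms
proof (cases rule: edge_cases)
  case (PP i j)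
  have "linear (\<lambda>d. Poly_Mapping.single i d - Poly_Mapping.single j (d :: real^2))"
    by (intro linear_compose_sub linear_single)
  then show ?thesis using PP by (simp add: edge_space_PP linear_subspace_image)
next
  case (PL i j)
  have "linear (\<lambda>(\<alpha>, \<beta>). Poly_Mapping.single i (\<alpha> *\<^sub>R b j) + Poly_Mapping.single j (axis 1 \<beta> :: real^2))"
    by (rule linearI)
      (auto simp: single_add[symmetric] scaleR_add_left scaleR_add_right scaleR_single scaleR_axis1
        add_axis1[symmetric] algebra_simps)
  then show ?thesis using PL by (simp add: edge_space_PL linear_subspace_image)
next
  case (LL i j)
  have "linear (\<lambda>(\<alpha>, \<beta>). Poly_Mapping.single i (axis 1 \<alpha>) + Poly_Mapping.single j (axis 1 \<beta> :: real^2))"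
    by (rule linearI)
      (auto simp: single_add[symmetric] scaleR_add_left scaleR_add_right scaleR_single scaleR_axis1
        add_axis1[symmetric] algebra_simps)
  then show ?thesis using LL by (simp add: edge_space_LL linear_subspace_image)
qed

lemma edge_space_subset:
  assumes "e \<in> E" "e \<inter> VP \<subseteq> P" "e \<inter> VL \<subseteq> L"
  shows "edge_space e \<subseteq> span (unit_rows P L)"
  using assms(1)
proof (cases rule: edge_cases)
  case (PP i j)
  then have "i \<in> P" "j \<in> P" using assms by auto
  then show ?thesis using PP
    by (auto simp: edge_space_PP single_point_in_span_unit_rows intro!: span_diff)
next
  case (PL i j)
  then have "i \<in> P" "j \<in> L" using assms by auto
  then show ?thesis using PL
    by (auto simp: edge_space_PL single_point_in_span_unit_rows single_line_in_span_unit_rows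
        intro!: span_add)
next
  case (LL i j)
  then have "i \<in> L" "j \<in> L" using assms by auto
  then show ?thesis using LL
    by (auto simp: edge_space_LL single_line_in_span_unit_rows intro!: span_add)
qed

text \<open>The weights \<open>s\<close> rescale the columns of the lines; the configuration \<open>p\<close> is itself the kernel
  vector \<open>(p, s)\<close> of the rows that represent it.\<close>
definition represents ::
  "('v \<Rightarrow> real^2) \<Rightarrow> ('v \<Rightarrow> real) \<Rightarrow> 'v set \<Rightarrow> ('v \<Rightarrow>\<^sub>0 real^2) \<Rightarrow> bool" where
  "represents p s e w \<longleftrightarrow>
     w \<in> edge_space e \<and> (\<forall>q \<sigma>. edge_ok p q \<sigma> e \<longleftrightarrow> cfg q (\<lambda>j. s j * \<sigma> j) w = 0)"

text \<open>Within the two-dimensional edge space, annihilating \<open>(p, s)\<close> is one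
  nontrivial linear condition as long as the weights are nonzero and the end points distinct. So a
  nonzero \<open>w\<close> is a multiple of the true row of the framework \<open>p\<close> with each
  line column divided by \<open>s\<close>. Pairing it with \<open>s j * \<sigma> j\<close> undoes
  the division.\<close>

lemma represents_edge_space:
  assumes "e \<in> E" "w \<in> edge_space e" "w \<noteq> 0" "cfg p s w = 0"
    and s: "\<And>j. j \<in> VL \<Longrightarrow> s j \<noteq> 0"
    and p: "\<And>i j. i \<in> VP \<Longrightarrow> j \<in> VP \<Longrightarrow> e = {i, j} \<Longrightarrow> p i \<noteq> p j"
  shows "represents p s e w"
proof -
  have "edge_ok p q \<sigma> e \<longleftrightarrow> cfg q (\<lambda>j. s j * \<sigma> j) w = 0" for q \<sigma>
    using assms(1)
  proof (cases rule: edge_cases)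
    case (PP i j)
    then obtain d where w: "w = Poly_Mapping.single i d - Poly_Mapping.single j d"
      using assms(2) edge_space_PP by auto
    have "d \<noteq> 0" using w assms(3) by auto
    moreover have "(p i - p j) \<bullet> d = 0" using w PP assms(4) by (simp add: inner_diff_left)
    moreover have "p i - p j \<noteq> 0" using p PP by auto
    ultimately have "(p i - p j) \<bullet> rot90 (q i - q j) = 0 \<longleftrightarrow> (q i - q j) \<bullet> d = 0"
      using orthogonal_rot90_iff by blast
    then show ?thesis using PP w by (simp add: edge_ok_PP inner_diff_left)
  next
    case (PL i j)
    then obtain \<alpha> \<beta> where
      w: "w = Poly_Mapping.single i (\<alpha> *\<^sub>R b j) + Poly_Mapping.single j (axis 1 \<beta>)"
      using assms(2) edge_space_PL by auto
    have 0: "\<alpha> * (p i \<bullet> b j) + s j * \<beta> = 0" using assms(4) w PL by simp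
    have "\<alpha> \<noteq> 0"
    proof
      assume "\<alpha> = 0"
      moreover from this 0 have "\<beta> = 0" using s PL by simp
      ultimately show False using w assms(3) by (simp add: axis1_zero)
    qed
    moreover have "cfg q (\<lambda>j. s j * \<sigma> j) w = \<alpha> * (q i \<bullet> b j) + \<sigma> j * (s j * \<beta>)"
      using w PL by simp
    then have "cfg q (\<lambda>j. s j * \<sigma> j) w = \<alpha> * (q i \<bullet> b j - \<sigma> j * (p i \<bullet> b j))"
      using 0 by algebra
    ultimately show ?thesis using PL by (simp add: edge_ok_PL)
  next
    case (LL i j)
    then obtain \<alpha> \<beta> where
      w: "w = Poly_Mapping.single i (axis 1 \<alpha>) + Poly_Mapping.single j (axis 1 \<beta>)"
      using assms(2) edge_space_LL by auto
    have 0: "s i * \<alpha> + s j * \<beta> = 0" using assms(4) w LL by simp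
    have "\<alpha> \<noteq> 0"
    proof
      assume "\<alpha> = 0"
      moreover from this 0 have "\<beta> = 0" using s LL by simp
      ultimately show False using w assms(3) by (simp add: axis1_zero)
    qed
    moreover have "cfg q (\<lambda>j. s j * \<sigma> j) w = s i * \<sigma> i * \<alpha> + s j * \<sigma> j * \<beta>"
      using w LL by simp
    then have "cfg q (\<lambda>j. s j * \<sigma> j) w = s i * \<alpha> * (\<sigma> i - \<sigma> j)"
      using 0 by algebra
    ultimately show ?thesis using LL s by (simp add: edge_ok_LL)
  qed
  then show ?thesis unfolding represents_def using assms(2) by blast
qed

text \<open>The velocities \<open>(p, 1)\<close> encode the rotation about the origin, which
  respects every constraint.\<close>

lemma edge_ok_self: "e \<in> E \<Longrightarrow> edge_ok p p (\<lambda>_. 1) e"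
  by (auto simp: edge_ok_def inner_real2 algebra_simps)

lemma represents_self: "e \<in> E \<Longrightarrow> represents p s e w \<Longrightarrow> cfg p s w = 0"
  using edge_ok_self[of e p] unfolding represents_def by auto

section \<open>Sufficiency: from independent rows to a minimally rigid framework\<close>

text \<open>Rigidity: the rows and one unit row of a line form a basis of the row space by the edge
  count, and a motion, weighted by \<open>s\<close>, agrees on this basis with a multiple of
  \<open>(p, s)\<close>. Minimality: independence provides a functional that annihilates all rows
  except that of \<open>e\<close>. It is a motion without \<open>e\<close>, but not a rotation, as
  rotations annihilate the row of \<open>e\<close> too.\<close>

lemma min_rigid_if_independent_rows:
  assumes card: "card E + 1 = 2 * card VP + card VL" and "VL \<noteq> {}"
    and s: "\<And>j. j \<in> VL \<Longrightarrow> s j \<noteq> 0"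
    and u: "inj_on u E" "independent (u ` E)" "\<And>e. e \<in> E \<Longrightarrow> represents p s e (u e)"
  shows "min_inf_fixed_intercept_rigid VP VL E p a"
proof -
  obtain j0 where j0: "j0 \<in> VL" using \<open>VL \<noteq> {}\<close> by blast
  \<comment> \<open>This row measures the angular velocity of one line. The rotation does not
    annihilate it, so it lies outside the span of the edge rows and fixes the factor
    \<open>t\<close> below.\<close>
  let ?x = "Poly_Mapping.single j0 (axis 1 1) :: 'v \<Rightarrow>\<^sub>0 real^2"
  have u_span: "u ` E \<subseteq> span (unit_rows VP VL)"
    using u(3) edge_space_subset[of _ VP VL] unfolding represents_def by blast
  have phi0: "cfg p s (u e) = 0" if "e \<in> E" for e using u(3) that represents_self by blast
  have x: "cfg p s ?x \<noteq> 0" using j0 s by simp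
  have "?x \<notin> span (u ` E)"
    by (rule not_in_span_if_functional[OF linear_config_pairing _ x]) (use phi0 in auto)
  then have xB: "?x \<notin> u ` E" "independent (insert ?x (u ` E))"
    using u(2) by (auto simp: independent_insert intro: span_base)
  have "card (insert ?x (u ` E)) = card (unit_rows VP VL)"
    using xB(1) finite_E card card_image[OF u(1)] card_unit_rows[OF fin disj] by simp
  moreover have "insert ?x (u ` E) \<subseteq> span (unit_rows VP VL)"
    using u_span single_line_in_span_unit_rows[OF j0] by simp
  ultimately have spans: "unit_rows VP VL \<subseteq> span (insert ?x (u ` E))"
    using independent_card_eq_spans[OF finite_unit_rows[OF fin] xB(2)] by simp
  then have spans: "span (unit_rows VP VL) \<subseteq> span (insert ?x (u ` E))"
    by (simp add: span_minimal subspace_span)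
  have "inf_fixed_intercept_rigid VP VL E p a"
    unfolding rigid_iff[OF order_refl]
  proof (intro allI impI)
    fix q \<sigma> assume ok: "\<forall>e\<in>E. edge_ok p q \<sigma> e"
    let ?\<psi> = "cfg q (\<lambda>j. s j * \<sigma> j)"
    define t where "t = ?\<psi> ?x / cfg p s ?x"
    have eq: "?\<psi> f = t * cfg p s f" if "f \<in> span (unit_rows VP VL)" for f
    proof (rule linear_eq_on[OF linear_config_pairing])
      show "linear (\<lambda>f. t * cfg p s f)"
        using linear_compose_scale_right[OF linear_config_pairing[of VP VL p s], of t] by simp
      show "f \<in> span (insert ?x (u ` E))" using that spans by blast
      fix y assume "y \<in> insert ?x (u ` E)"
      then show "?\<psi> y = t * cfg p s y"
        using ok u(3) phi0 x unfolding represents_def t_def by auto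
    qed
    have "q i = t *\<^sub>R p i" if "i \<in> VP" for i
    proof -
      have "(q i - t *\<^sub>R p i) \<bullet> d = 0" for d
        using eq[OF single_point_in_span_unit_rows[OF that], of d] that
        by (simp add: inner_diff_left)
      then show ?thesis using inner_eq_zero_iff by (metis eq_iff_diff_eq_0)
    qed
    moreover have "\<sigma> j = t" if "j \<in> VL" for j
      using eq[OF single_line_in_span_unit_rows[OF that], of 1] that s by simp
    ultimately show "\<exists>t. (\<forall>i\<in>VP. q i = t *\<^sub>R p i) \<and> (\<forall>j\<in>VL. \<sigma> j = t)" by blast
  qed
  moreover have "\<not> inf_fixed_intercept_rigid VP VL (E - {e}) p a" if e: "e \<in> E" for e
  proof
    assume r: "inf_fixed_intercept_rigid VP VL (E - {e}) p a"
    let ?S = "u ` (E - {e})"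
    have S: "?S = u ` E - {u e}" using u(1) e by (auto dest: inj_onD)
    have "independent ?S" unfolding S by (rule independent_mono[OF u(2) Diff_subset])
    moreover have "u e \<notin> span ?S" using u(2) e unfolding S dependent_def by simp
    ultimately have "\<exists>\<psi> :: ('v \<Rightarrow>\<^sub>0 real^2) \<Rightarrow> real.
        linear \<psi> \<and> (\<forall>y\<in>?S. \<psi> y = 0) \<and> (\<forall>x\<in>{u e}. \<psi> x \<noteq> 0)"
      by (intro functional_separating) auto
    then obtain \<psi> :: "('v \<Rightarrow>\<^sub>0 real^2) \<Rightarrow> real" where
      \<psi>: "linear \<psi>" "\<forall>y\<in>?S. \<psi> y = 0" "\<psi> (u e) \<noteq> 0"
      by auto
    obtain q r where q: "\<forall>f\<in>span (unit_rows VP VL). \<psi> f = cfg q r f"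
      using functional_eq_config_pairing[OF \<psi>(1) fin disj] by (elim exE conjE)
    \<comment> \<open>The functional has line coordinates \<open>r\<close> in the rescaled columns;
      dividing by \<open>s\<close> gives the actual angular velocities.\<close>
    define \<sigma> where "\<sigma> j = r j / s j" for j
    have cfg_r: "cfg q r f = cfg q (\<lambda>j. s j * \<sigma> j) f" for f
      using s by (simp add: config_pairing_def \<sigma>_def)
    have "edge_ok p q \<sigma> f" if "f \<in> E - {e}" for f
      using that \<psi>(2) bspec[OF q, of "u f"] u_span u(3)[of f] cfg_r[of "u f"]
      unfolding represents_def by (simp add: image_subset_iff)
    then obtain t where t: "\<forall>i\<in>VP. q i = t *\<^sub>R p i" "\<forall>j\<in>VL. \<sigma> j = t"
      using r rigid_iff[of "E - {e}" p] by blast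
    have "cfg q (\<lambda>j. s j * \<sigma> j) f = t * cfg p s f" for f
      using t by (simp add: config_pairing_def sum_distrib_left distrib_left algebra_simps)
    then have "\<psi> (u e) = 0" using bspec[OF q, of "u e"] u_span e phi0[OF e] cfg_r[of "u e"]
      by (simp add: image_subset_iff)
    then show False using \<psi>(3) by blast
  qed
  ultimately show ?thesis unfolding min_inf_fixed_intercept_rigid_def by blast
qed

lemma realisation_if_rank:
  assumes card: "card E + 1 = 2 * card VP + card VL" and VL: "VL \<noteq> {}"
    and rank: "\<And>F. F \<subseteq> E \<Longrightarrow> F \<noteq> {} \<Longrightarrow> rank_ge (card F + 1) (\<Union>(edge_space ` F))"
  shows "\<exists>p. min_inf_fixed_intercept_rigid VP VL E p a"
proof -
  \<comment> \<open>A functional that is nonzero on the first family has nonzero line weights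
    \<open>s j\<close>. On the second family it separates the first coordinates of
    \<open>p i\<close> and \<open>p j\<close>, which is enough for distinct end points.\<close>
  define X :: "('v \<Rightarrow>\<^sub>0 real^2) set" where
    "X = (\<lambda>j. Poly_Mapping.single j (axis 1 1)) ` VL \<union>
      (\<lambda>(i, j). Poly_Mapping.single i (axis 1 1) - Poly_Mapping.single j (axis 1 1)) `
        {(i, j). i \<in> VP \<and> j \<in> VP \<and> {i, j} \<in> E}"
  have "finite {(i, j). i \<in> VP \<and> j \<in> VP \<and> {i, j} \<in> E}"
    by (rule finite_subset[of _ "VP \<times> VP"]) (use fin in auto)
  then have "finite X" unfolding X_def using fin by blast
  moreover have "X \<noteq> {}" unfolding X_def using VL by blast
  moreover have "0 \<notin> X"
  proof
    assume "0 \<in> X"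
    then consider j where "(0 :: 'v \<Rightarrow>\<^sub>0 real^2) = Poly_Mapping.single j (axis 1 1)"
      | i j where "{i, j} \<in> E"
        "(0 :: 'v \<Rightarrow>\<^sub>0 real^2) = Poly_Mapping.single i (axis 1 1) - Poly_Mapping.single j (axis 1 1)"
      unfolding X_def by auto
    then show False
    proof cases
      case 1
      then have "Poly_Mapping.lookup (Poly_Mapping.single j (axis 1 1 :: real^2)) j = 0"
        by (metis lookup_zero)
      then show False by simp
    next
      case 2
      then have "i \<noteq> j" using edge_distinct by blast
      moreover have "Poly_Mapping.lookup (Poly_Mapping.single i (axis 1 1 :: real^2)
          - Poly_Mapping.single j (axis 1 1)) i = 0"
        using 2(2) by (metis lookup_zero)
      ultimately show False by (simp add: lookup_minus lookup_single when_def)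
    qed
  qed
  ultimately have "\<exists>u. (\<forall>e\<in>E. u e \<in> edge_space e) \<and> inj_on u E \<and> independent (u ` E) \<and>
      (\<forall>x\<in>X. x \<notin> span (u ` E))"
    using finite_E subspace_edge_space rank by (intro generic_selection)
  then obtain u where u: "\<forall>e\<in>E. u e \<in> edge_space e" "inj_on u E" "independent (u ` E)"
    "\<forall>x\<in>X. x \<notin> span (u ` E)"
    by (elim exE conjE)
  obtain \<phi> :: "('v \<Rightarrow>\<^sub>0 real^2) \<Rightarrow> real" where
    \<phi>: "linear \<phi>" "\<forall>y\<in>u ` E. \<phi> y = 0" "\<forall>x\<in>X. \<phi> x \<noteq> 0"
    using functional_separating[OF \<open>finite X\<close> u(3)] u(4) by auto
  obtain p s where ps: "\<forall>f\<in>span (unit_rows VP VL). \<phi> f = cfg p s f"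
    "\<forall>j. s j = \<phi> (Poly_Mapping.single j (axis 1 1))"
    "\<forall>i\<in>VP. \<forall>d. p i \<bullet> d = \<phi> (Poly_Mapping.single i d)"
    using functional_eq_config_pairing[OF \<phi>(1) fin disj] by (elim exE conjE)
  have s: "s j \<noteq> 0" if "j \<in> VL" for j using that \<phi>(3) ps(2) unfolding X_def by simp
  have rep: "represents p s e (u e)" if e: "e \<in> E" for e
  proof (rule represents_edge_space[OF e bspec[OF u(1) e] _ _ s])
    show "u e \<noteq> 0" using u(3) e dependent_zero[of "u ` E"] by (metis imageI)
    have "u e \<in> span (unit_rows VP VL)" using edge_space_subset[OF e, of VP VL] bspec[OF u(1) e] by auto
    then have "\<phi> (u e) = cfg p s (u e)" using ps(1) by (rule bspec[rotated])
    then show "cfg p s (u e) = 0" using bspec[OF \<phi>(2) imageI[OF e]] by simp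
    show "p i \<noteq> p j" if "i \<in> VP" "j \<in> VP" "e = {i, j}" for i j
    proof
      assume "p i = p j"
      then have "\<phi> (Poly_Mapping.single i (axis 1 1) - Poly_Mapping.single j (axis 1 1)) = 0"
        by (simp only: linear_diff[OF \<phi>(1)] diff_self
            bspec[OF ps(3) that(1), THEN spec, symmetric] bspec[OF ps(3) that(2), THEN spec, symmetric])
      moreover have "Poly_Mapping.single i (axis 1 1) - Poly_Mapping.single j (axis 1 1) \<in> X"
        using that e unfolding X_def by auto
      ultimately show False using \<phi>(3) by blast
    qed
  qed
  show ?thesis
    by (rule exI[of _ p], rule min_rigid_if_independent_rows[where s = s and u = u, OF card VL])
      (use s u(2,3) rep in auto)
qed

section \<open>Sufficiency: the rank of the edge spaces under sparsity\<close>

text \<open>The rank is bounded from below by counting the rows that must be added to generate all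
  unit rows of the incident vertices. Sparsity is applied separately to the edges meeting each class
  \<open>K\<close> and to the remaining edges \<open>F0\<close>. Compared with the rank,
  \<open>K\<close> leaves a surplus \<open>1 - card (LK K)\<close> and \<open>F0\<close> leaves
  \<open>2 * card Z + card L - card F0\<close>; none of these is negative and at least one is
  positive.\<close>

lemma rank_edge_spaces:
  assumes F: "F \<subseteq> E" "F \<noteq> {}"
    and sparse: "\<And>F'. F' \<subseteq> F \<Longrightarrow> F' \<noteq> {} \<Longrightarrow> sparse_count VP VL F'"
  shows "rank_ge (card F + 1) (\<Union>(edge_space ` F))"
proof -
  define S where "S = \<Union>(edge_space ` F)"
  define P where "P = incident_vertices VP F"
  define L where "L = incident_vertices VL F"
  have PL_sub: "P \<subseteq> VP" "L \<subseteq> VL" unfolding P_def L_def incident_vertices_def by auto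
  have finPL: "finite P" "finite L" using PL_sub fin finite_subset by auto
  have disjPL: "P \<inter> L = {}" using PL_sub disj by auto
  have finF: "finite F" using F finite_E finite_subset by auto
  have in_S: "x \<in> span S" if "x \<in> edge_space e" "e \<in> F" for x e
    using that unfolding S_def by (intro span_base) auto
  \<comment> \<open>The two coefficients of a row at a line vary independently, so the other one can
    be set to 0. Hence every incident line is pinned, and only points can be missing from the
    span.\<close>
  have line: "Poly_Mapping.single j (axis 1 c) \<in> span S" if jL: "j \<in> L" for j c
  proof -
    obtain e where e': "e \<in> F" "j \<in> e" "j \<in> VL"
      using jL unfolding L_def incident_vertices_def by auto
    have "j \<notin> VP" using e'(3) disj by auto
    note e = e' this
    from F e(1) have "e \<in> E" by auto
    then have "Poly_Mapping.single j (axis 1 c) \<in> edge_space e"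
    proof (cases rule: edge_cases)
      case (PP i k)
      then show ?thesis using e by auto
    next
      case (PL i k)
      then have "k = j" using e by auto
      then show ?thesis using PL
        by (auto simp: edge_space_PL intro!: range_eqI[of _ _ "(0, c)"])
    next
      case (LL i k)
      have "Poly_Mapping.single i (axis 1 c) \<in> edge_space e"
        using LL by (auto simp: edge_space_LL axis1_zero intro!: range_eqI[of _ _ "(c, 0)"])
      moreover have "Poly_Mapping.single k (axis 1 c) \<in> edge_space e"
        using LL by (auto simp: edge_space_LL axis1_zero intro!: range_eqI[of _ _ "(0, c)"])
      ultimately show ?thesis using LL(4) e(2) by auto
    qed
    then show ?thesis using in_S e(1) by simp
  qed
  \<comment> \<open>Points of \<open>P - U\<close> are pinned by the rows. The unpinned points fall into classes moving by a common
    translation; a class sees at most one line, as two lines would pin it, so adding \<open>2 - card (LK K)\<close>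
    rows per class \<open>K\<close> generates everything.\<close>
  define U where "U = {i \<in> P. \<exists>d. Poly_Mapping.single i d \<notin> span S}"
  define R where "R = {(i, k) \<in> U \<times> U. \<forall>d. Poly_Mapping.single i d - Poly_Mapping.single k d \<in> span S}"
  define Q where "Q = U // R"
  have finU: "finite U" "U \<subseteq> VP" using finPL PL_sub unfolding U_def by auto
  have equiv: "equiv U R"
  proof (rule equivI)
    show "refl_on U R" unfolding refl_on_def R_def by (auto simp: span_zero)
    show "R \<subseteq> U \<times> U" unfolding R_def by auto
    show "sym R"
    proof (rule symI)
      fix i k assume "(i, k) \<in> R"
      then have "i \<in> U" "k \<in> U"
        and r: "\<And>d. Poly_Mapping.single i d - Poly_Mapping.single k d \<in> span S"
        unfolding R_def by auto
      then show "(k, i) \<in> R" unfolding R_def using span_neg[OF r] by simp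
    qed
    show "trans R"
    proof (rule transI)
      fix i k l assume "(i, k) \<in> R" "(k, l) \<in> R"
      then have il: "i \<in> U" "l \<in> U"
        and ik: "\<And>d. Poly_Mapping.single i d - Poly_Mapping.single k d \<in> span S"
        and kl: "\<And>d. Poly_Mapping.single k d - Poly_Mapping.single l d \<in> span S"
        unfolding R_def by auto
      have "Poly_Mapping.single i d - Poly_Mapping.single l d \<in> span S" for d
        using span_add[OF ik kl, of d d] by simp
      then show "(i, l) \<in> R" using il unfolding R_def by simp
    qed
  qed
  have finQ: "finite Q" unfolding Q_def using finU equiv
    by (simp add: finite_quotient equiv_type)
  have QU: "\<Union>Q = U" unfolding Q_def by (rule Union_quotient[OF equiv])
  have K_sub: "K \<subseteq> U" "K \<noteq> {}" if "K \<in> Q" for K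
    using that QU in_quotient_imp_non_empty[OF equiv] unfolding Q_def by auto
  have K_rel: "Poly_Mapping.single i d - Poly_Mapping.single k d \<in> span S"
    if "K \<in> Q" "i \<in> K" "k \<in> K" for K i k d
    using quotient_eq_iff[OF equiv _ _ that(2,3)] that(1) unfolding Q_def R_def by auto
  define FK where "FK K = {e \<in> F. e \<inter> K \<noteq> {}}" for K
  define LK where "LK K = incident_vertices VL (FK K)" for K
  have LK_sub: "LK K \<subseteq> L" for K unfolding LK_def L_def FK_def incident_vertices_def by auto
  have finLK: "finite (LK K)" for K using LK_sub finPL finite_subset by metis
  \<comment> \<open>A point-point edge puts the difference of its end points into the span for every
    \<open>d\<close>. So both ends are pinned or both are unpinned, and in the latter case they
    share a class.\<close>
  have PK: "incident_vertices VP (FK K) \<subseteq> K" if K: "K \<in> Q" for K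
  proof
    fix k assume "k \<in> incident_vertices VP (FK K)"
    then obtain e where e: "k \<in> VP" "e \<in> F" "k \<in> e" "e \<inter> K \<noteq> {}"
      unfolding incident_vertices_def FK_def by auto
    then obtain i where i: "i \<in> e" "i \<in> K" by auto
    show "k \<in> K"
    proof (cases "i = k")
      case False
      have iU: "i \<in> U" using i K K_sub by auto
      then have iVP: "i \<in> VP" using finU by auto
      have "e \<in> E" using e F by auto
      then have "e = {i, k}" using False i(1) e(3) by (cases rule: edge_cases) auto
      then have r: "Poly_Mapping.single i d - Poly_Mapping.single k d \<in> span S" for d
        using edge_space_PP[OF iVP e(1)] in_S e(2) by auto
      have "k \<in> U"
      proof (rule ccontr)
        assume "k \<notin> U"
        then have "Poly_Mapping.single k d \<in> span S" for d
          using e unfolding U_def P_def incident_vertices_def by auto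
        then have "Poly_Mapping.single i d \<in> span S" for d
          by (rule span_if_diff[OF r])
        then show False using iU unfolding U_def by auto
      qed
      then have "(i, k) \<in> R" using r iU unfolding R_def by auto
      then show ?thesis using in_quotient_imp_closed[OF equiv] K i(2) unfolding Q_def by auto
    qed (use i in simp)
  qed
  have LK_row: "Poly_Mapping.single r (b j) \<in> span S" if Kjr: "K \<in> Q" "j \<in> LK K" "r \<in> K" for K j r
  proof -
    obtain e i where e: "e \<in> F" "j \<in> e" "j \<in> VL" "i \<in> e" "i \<in> K"
      using Kjr unfolding LK_def FK_def incident_vertices_def by auto
    have iVP: "i \<in> VP" using e(5) K_sub[OF that(1)] finU by auto
    then have "i \<noteq> j" using e disj by auto
    have "e \<in> E" using e F by auto
    then have "e = {i, j}" using \<open>i \<noteq> j\<close> e(2,4) by (cases rule: edge_cases) auto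
    then have "Poly_Mapping.single i (b j) \<in> edge_space e"
      using edge_space_PL[OF iVP e(3)] by (auto simp: axis1_zero intro!: range_eqI[of _ _ "(1, 0)"])
    then have "Poly_Mapping.single i (b j) \<in> span S" using in_S e(1) by simp
    then show ?thesis by (rule span_if_diff[OF K_rel[OF Kjr(1,3) e(5)]])
  qed
  have LK_card: "card (LK K) \<le> 1" if K: "K \<in> Q" for K
  proof -
    have "j = k" if jk: "j \<in> LK K" "k \<in> LK K" for j k
    proof (rule ccontr)
      assume "j \<noteq> k"
      obtain r where r: "r \<in> K" using K_sub[OF K] by auto
      have "Poly_Mapping.single r d \<in> span S" for d
      proof -
        have "j \<in> VL" "k \<in> VL" using jk LK_sub PL_sub by auto
        then obtain \<alpha> \<beta> where d: "d = \<alpha> *\<^sub>R b j + \<beta> *\<^sub>R b k" using b_spans \<open>j \<noteq> k\<close> by metis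
        have "Poly_Mapping.single r d
            = \<alpha> *\<^sub>R Poly_Mapping.single r (b j) + \<beta> *\<^sub>R Poly_Mapping.single r (b k)"
          unfolding d by (simp add: scaleR_single single_add)
        then show ?thesis
          using LK_row[OF K jk(1) r] LK_row[OF K jk(2) r] by (simp add: span_add span_scale)
      qed
      then show False using r K_sub[OF K] unfolding U_def by auto
    qed
    then show ?thesis using card_le_Suc0_iff_eq[OF finLK] by simp
  qed
  \<comment> \<open>Generating the rows of one representative \<open>r\<close> generates the whole
    class. Without a line this takes two unit rows; with a line \<open>j\<close> the row along
    \<open>b j\<close> is already present, and \<open>a j\<close> completes it to an orthonormal
    basis.\<close>
  have "\<exists>C. finite C \<and> card C \<le> 2 - card (LK K) \<and>
      (\<forall>i\<in>K. \<forall>d. Poly_Mapping.single i d \<in> span (S \<union> C))" if K: "K \<in> Q" for K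
  proof -
    obtain r where r: "r \<in> K" using K_sub[OF K] by auto
    have extend: "\<forall>i\<in>K. \<forall>d. Poly_Mapping.single i d \<in> span (S \<union> C)"
      if C: "\<And>d. Poly_Mapping.single r d \<in> span (S \<union> C)" for C
    proof (intro ballI allI)
      fix i d assume "i \<in> K"
      then have "Poly_Mapping.single i d - Poly_Mapping.single r d \<in> span (S \<union> C)"
        using K_rel[OF K _ r] span_mono[of S "S \<union> C"] by auto
      then show "Poly_Mapping.single i d \<in> span (S \<union> C)" by (rule span_if_diff[OF _ C])
    qed
    show ?thesis
    proof (cases "LK K = {}")
      case True
      let ?C = "(\<lambda>k. Poly_Mapping.single r (axis k 1) :: 'v \<Rightarrow>\<^sub>0 real^2) ` UNIV"
      have "Poly_Mapping.single r d \<in> span (S \<union> ?C)" for d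
        by (rule single_point_in_span) (auto intro!: span_base)
      moreover have "card ?C \<le> 2"
        using card_image_le[of "UNIV :: 2 set" "\<lambda>k. Poly_Mapping.single r (axis k 1) :: 'v \<Rightarrow>\<^sub>0 real^2"] by simp
      ultimately show ?thesis using True extend[of ?C] by (intro exI[of _ ?C]) auto
    next
      case False
      then obtain j where j: "j \<in> LK K" by auto
      then have jVL: "j \<in> VL" using LK_sub PL_sub by auto
      let ?C = "{Poly_Mapping.single r (a j)}"
      have "Poly_Mapping.single r d \<in> span (S \<union> ?C)" for d
      proof -
        have "Poly_Mapping.single r d = (d \<bullet> b j) *\<^sub>R Poly_Mapping.single r (b j)
            + (d \<bullet> a j) *\<^sub>R Poly_Mapping.single r (a j)"
          by (subst orthonormal_expansion[OF jVL, of d]) (simp add: scaleR_single single_add)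
        moreover have "Poly_Mapping.single r (b j) \<in> span (S \<union> ?C)"
          using LK_row[OF K j r] span_mono[of S "S \<union> ?C"] by auto
        moreover have "Poly_Mapping.single r (a j) \<in> span (S \<union> ?C)" by (rule span_base) simp
        ultimately show ?thesis by (simp add: span_add span_scale)
      qed
      then show ?thesis using extend[of ?C] LK_card[OF K] by (intro exI[of _ ?C]) auto
    qed
  qed
  then obtain C where C: "\<And>K. K \<in> Q \<Longrightarrow> finite (C K)"
    "\<And>K. K \<in> Q \<Longrightarrow> card (C K) \<le> 2 - card (LK K)"
    "\<And>K i d. K \<in> Q \<Longrightarrow> i \<in> K \<Longrightarrow> Poly_Mapping.single i d \<in> span (S \<union> C K)"
    by metis
  define D where "D = (\<Union>K\<in>Q. C K)"
  have finD: "finite D" unfolding D_def using finQ C(1) by auto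
  have cardD: "card D \<le> (\<Sum>K\<in>Q. 2 - card (LK K))"
    unfolding D_def using card_UN_le[OF finQ, of C] sum_mono[of Q "\<lambda>K. card (C K)"] C(2)
    by (meson order_trans)
  have point: "Poly_Mapping.single i d \<in> span (S \<union> D)" if i: "i \<in> P" for i d
  proof (cases "i \<in> U")
    case True
    then obtain K where "K \<in> Q" "i \<in> K" using QU by auto
    then show ?thesis using C(3) span_mono[of "S \<union> C K" "S \<union> D"] unfolding D_def by auto
  next
    case False
    then have "Poly_Mapping.single i d \<in> span S" using i unfolding U_def by auto
    then show ?thesis using span_mono[of S "S \<union> D"] by auto
  qed
  have units: "unit_rows P L \<subseteq> span (S \<union> D)"
  proof -
    have "Poly_Mapping.single j (axis 1 1) \<in> span (S \<union> D)" if "j \<in> L" for j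
      using line[OF that] span_mono[of S "S \<union> D"] by auto
    then show ?thesis unfolding unit_rows_def using point by auto
  qed
  have "S \<subseteq> span (unit_rows P L)"
    unfolding S_def
  proof (rule UN_least)
    fix e assume e: "e \<in> F"
    then have "e \<in> E" using F by auto
    then show "edge_space e \<subseteq> span (unit_rows P L)"
      by (rule edge_space_subset) (use e in \<open>auto simp: P_def L_def incident_vertices_def\<close>)
  qed
  then obtain n where n: "rank_ge n S" "card (unit_rows P L) \<le> n + card D"
    using card_le_card_complement[OF finite_unit_rows[OF finPL] independent_unit_rows units finD]
    by metis
  define F0 where "F0 = {e \<in> F. e \<inter> U = {}}"
  define Z where "Z = P - U"
  have cardP: "card P = card Z + card U"
    unfolding Z_def using finPL finU by (simp add: U_def card_Diff_subset card_mono)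
  have cardU: "card U = (\<Sum>K\<in>Q. card K)"
  proof -
    have "card (\<Union>Q) = sum card Q"
    proof (rule card_Union_disjoint)
      show "disjoint Q"
        using quotient_disj[OF equiv] unfolding Q_def disjnt_def pairwise_def by metis
      show "finite K" if "K \<in> Q" for K using K_sub[OF that] finU finite_subset by metis
    qed
    then show ?thesis using QU by simp
  qed
  have "F \<subseteq> F0 \<union> (\<Union>K\<in>Q. FK K)"
  proof
    fix e assume e: "e \<in> F"
    show "e \<in> F0 \<union> (\<Union>K\<in>Q. FK K)"
    proof (cases "e \<inter> U = {}")
      case True
      then show ?thesis using e unfolding F0_def by simp
    next
      case False
      then obtain K where "K \<in> Q" "e \<inter> K \<noteq> {}" using QU by auto
      then show ?thesis using e unfolding FK_def by auto
    qed
  qed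
  moreover have finFK: "finite (FK K)" and finF0: "finite F0" for K
    using finF unfolding FK_def F0_def by auto
  ultimately have "card F \<le> card (F0 \<union> (\<Union>K\<in>Q. FK K))"
    using finQ by (intro card_mono) auto
  also have "\<dots> \<le> card F0 + card (\<Union>K\<in>Q. FK K)" by (rule card_Un_le)
  also have "\<dots> \<le> card F0 + (\<Sum>K\<in>Q. card (FK K))" using card_UN_le[OF finQ, of FK] by simp
  finally have cardF: "int (card F) \<le> int (card F0) + (\<Sum>K\<in>Q. int (card (FK K)))"
    by (metis of_nat_add of_nat_le_iff of_nat_sum)
  \<comment> \<open>A class sees at most one line, so the minimum with 2 equals
    \<open>card (LK K)\<close>; added to the line count it gives the factor 2.\<close>
  have FK_le: "int (card (FK K)) \<le> 2 * int (card K) - 3 + 2 * int (card (LK K))" if K: "K \<in> Q" for K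
  proof -
    obtain r where r: "r \<in> K" "r \<in> P" using K_sub[OF K] unfolding U_def by auto
    then have "FK K \<noteq> {}" unfolding FK_def P_def incident_vertices_def by auto
    then have "sparse_count VP VL (FK K)" using sparse[of "FK K"] unfolding FK_def by simp
    moreover have "nu VP (FK K) \<le> card K"
      unfolding nu_def using PK[OF K] K_sub[OF K] finU by (metis card_mono finite_subset)
    ultimately show ?thesis using LK_card[OF K] unfolding sparse_count_def nu_def LK_def by simp
  qed
  \<comment> \<open>Here the minimum is only bounded by 2, which turns -3 into -1. The points of
    these edges all lie in \<open>Z\<close>.\<close>
  have F0_le: "int (card F0) \<le> 2 * int (card Z) + int (card L) - 1" if "F0 \<noteq> {}"
  proof -
    have "sparse_count VP VL F0" using sparse[of F0] that unfolding F0_def by simp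
    moreover have "nu VP F0 \<le> card Z" unfolding nu_def Z_def
      by (rule card_mono) (use finPL in \<open>auto simp: F0_def P_def incident_vertices_def\<close>)
    moreover have "nu VL F0 \<le> card L" unfolding nu_def
      by (rule card_mono) (use finPL in \<open>auto simp: F0_def L_def incident_vertices_def\<close>)
    ultimately show ?thesis unfolding sparse_count_def by simp
  qed
  have "(\<Sum>K\<in>Q. int (card (FK K))) \<le> (\<Sum>K\<in>Q. 2 * int (card K) - 3 + 2 * int (card (LK K)))"
    by (rule sum_mono) (rule FK_le)
  also have "\<dots> = 2 * int (card U) - 3 * int (card Q) + 2 * (\<Sum>K\<in>Q. int (card (LK K)))"
    unfolding cardU by (simp add: sum.distrib sum_subtractf sum_distrib_left)
  finally have sumFK: "(\<Sum>K\<in>Q. int (card (FK K))) \<le>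
      2 * int (card U) - 3 * int (card Q) + 2 * (\<Sum>K\<in>Q. int (card (LK K)))" .
  have "int (card D) \<le> (\<Sum>K\<in>Q. int (2 - card (LK K)))" using cardD by (metis of_nat_le_iff of_nat_sum)
  also have "\<dots> = (\<Sum>K\<in>Q. 2 - int (card (LK K)))"
    by (rule sum.cong) (use LK_card in \<open>auto simp: of_nat_diff dest!: LK_card\<close>)
  also have "\<dots> = 2 * int (card Q) - (\<Sum>K\<in>Q. int (card (LK K)))"
    by (simp add: sum_subtractf)
  finally have cD: "int (card D) \<le> 2 * int (card Q) - (\<Sum>K\<in>Q. int (card (LK K)))" .
  have LKQ: "(\<Sum>K\<in>Q. int (card (LK K))) \<le> int (card Q)"
    using sum_mono[of Q "\<lambda>K. int (card (LK K))" "\<lambda>_. 1"] LK_card by simp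
  have "2 * card P + card L \<le> n + card D" using n(2) card_unit_rows[OF finPL disjPL] by simp
  \<comment> \<open>The total surplus. A nonempty \<open>F0\<close> provides the unit by its own
    sparsity bound; if \<open>F0\<close> is empty, any pinned point or any line does. If there is
    neither, every class sees no line and contributes 1, and a class exists because \<open>F\<close>
    is nonempty.\<close>
  moreover have "1 \<le> 2 * int (card Z) + int (card L) - int (card F0)
      + (int (card Q) - (\<Sum>K\<in>Q. int (card (LK K))))"
  proof (cases "F0 = {}")
    case False
    then show ?thesis using F0_le LKQ by simp
  next
    case F0: True
    show ?thesis
    proof (cases "card Z = 0 \<and> card L = 0")
      case False
      then show ?thesis using F0 LKQ by auto
    next
      case True
      then have "L = {}" "Z = {}" using finPL unfolding Z_def by auto
      then have "card (LK K) = 0" for K using LK_sub[of K] by simp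
      moreover have "Q \<noteq> {}"
      proof
        assume "Q = {}"
        then have "F = F0" using QU unfolding F0_def by auto
        then show False using F(2) F0 by simp
      qed
      ultimately show ?thesis using F0 True finQ by (simp add: Suc_le_eq card_gt_0_iff)
    qed
  qed
  ultimately have "card F + 1 \<le> n" using cardF sumFK cD cardP by linarith
  then show ?thesis using rank_ge_le n(1) unfolding S_def by blast
qed

section \<open>Necessity: rows of a given minimally rigid framework\<close>

text \<open>The witnesses are the rows of the rigidity matrix in rotated coordinates. All weights
  are 1, since the framework is given and no column needs rescaling.\<close>

lemma ex_represents:
  assumes "e \<in> E"
  shows "\<exists>w. represents p (\<lambda>_. 1) e w"
  using assms
proof (cases rule: edge_cases)
  case (PP i j)
  define d where "d = rot90 (p i - p j)"
  have "(p i - p j) \<bullet> rot90 (q i - q j) = - (q i \<bullet> d - q j \<bullet> d)" for q :: "'v \<Rightarrow> real^2"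
    by (simp add: d_def inner_real2 algebra_simps)
  then have "represents p (\<lambda>_. 1) e (Poly_Mapping.single i d - Poly_Mapping.single j d)"
    using PP by (auto simp: represents_def edge_ok_PP edge_space_PP)
  then show ?thesis ..
next
  case (PL i j)
  define c where "c = p i \<bullet> b j"
  have "Poly_Mapping.single i (b j) + Poly_Mapping.single j (axis 1 (- c)) \<in> edge_space e"
    using PL by (auto simp: edge_space_PL intro!: range_eqI[of _ _ "(1, - c)"])
  then have "represents p (\<lambda>_. 1) e (Poly_Mapping.single i (b j) + Poly_Mapping.single j (axis 1 (- c)))"
    using PL by (auto simp: represents_def edge_ok_PL c_def)
  then show ?thesis ..
next
  case (LL i j)
  have "Poly_Mapping.single i (axis 1 1) + Poly_Mapping.single j (axis 1 (- 1)) \<in> edge_space e"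
    using LL by (auto simp: edge_space_LL intro!: range_eqI[of _ _ "(1, - 1)"])
  then have "represents p (\<lambda>_. 1) e
      (Poly_Mapping.single i (axis 1 1) + Poly_Mapping.single j (axis 1 (- 1)))"
    using LL by (auto simp: represents_def edge_ok_LL)
  then show ?thesis ..
qed

text \<open>If a row lay in the span of the rows of the other edges, its constraint would follow
  from theirs and deleting the edge would keep rigidity. Since the other edges are removed from the
  index set rather than from the set of rows, this also excludes two edges with the same
  row.\<close>

lemma independent_rows_if_min_rigid:
  assumes "min_inf_fixed_intercept_rigid VP VL E p a"
  shows "\<exists>u. (\<forall>e\<in>E. represents p (\<lambda>_. 1) e (u e)) \<and> inj_on u E \<and> independent (u ` E)"
proof -
  have "\<forall>e\<in>E. \<exists>w. represents p (\<lambda>_. 1) e w" using ex_represents by simp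
  from bchoice[OF this] obtain u where u: "\<forall>e\<in>E. represents p (\<lambda>_. 1) e (u e)" ..
  have not_in: "u e \<notin> span (u ` (E - {e}))" if e: "e \<in> E" for e
  proof
    assume in_span: "u e \<in> span (u ` (E - {e}))"
    have "inf_fixed_intercept_rigid VP VL (E - {e}) p a"
      unfolding rigid_iff[OF Diff_subset]
    proof (intro allI impI)
      fix q \<sigma> assume ok: "\<forall>f\<in>E - {e}. edge_ok p q \<sigma> f"
      have "cfg q \<sigma> (u f) = 0" if "f \<in> E - {e}" for f
        using bspec[OF ok that] bspec[OF u, of f] that unfolding represents_def by simp
      then have "cfg q \<sigma> (u e) = 0"
        using linear_eq_0_on_span[OF linear_config_pairing _ in_span, of VP VL q \<sigma>] by auto
      then have "edge_ok p q \<sigma> e" using bspec[OF u e] unfolding represents_def by simp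
      then have all: "\<forall>f\<in>E. edge_ok p q \<sigma> f" using ok by auto
      have "inf_fixed_intercept_rigid VP VL E p a"
        using assms unfolding min_inf_fixed_intercept_rigid_def by simp
      then show "\<exists>t. (\<forall>i\<in>VP. q i = t *\<^sub>R p i) \<and> (\<forall>j\<in>VL. \<sigma> j = t)"
        unfolding rigid_iff[OF order_refl] using all by simp
    qed
    then show False using assms e unfolding min_inf_fixed_intercept_rigid_def by simp
  qed
  have inj: "inj_on u E"
  proof (rule inj_onI, rule ccontr)
    fix e f assume "e \<in> E" "f \<in> E" "u e = u f" "e \<noteq> f"
    then have "u e \<in> u ` (E - {e})" by auto
    then show False using not_in[OF \<open>e \<in> E\<close>] span_base by metis
  qed
  moreover have "independent (u ` E)"
    unfolding dependent_def
  proof (intro notI, elim bexE)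
    fix x assume "x \<in> u ` E" "x \<in> span (u ` E - {x})"
    then obtain e where e: "e \<in> E" "x = u e" by auto
    then have "u ` E - {x} \<subseteq> u ` (E - {e})" by auto
    then show False using not_in[OF e(1)] \<open>x \<in> span (u ` E - {x})\<close> e(2) span_mono by blast
  qed
  ultimately show ?thesis using u by auto
qed

text \<open>The edge rows and one unit row of a line are independent because the rotation separates
  them. They span everything, since a functional that annihilates them is a motion, hence a multiple
  \<open>t\<close> of the rotation, and its value on the unit row makes \<open>t\<close>
  zero.\<close>

lemma card_if_rigid:
  assumes rigid: "inf_fixed_intercept_rigid VP VL E p a" and j0: "j0 \<in> VL"
    and u: "\<forall>e\<in>E. represents p (\<lambda>_. 1) e (u e)" "inj_on u E" "independent (u ` E)"
  shows "card E + 1 = 2 * card VP + card VL"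
proof -
  let ?x = "Poly_Mapping.single j0 (axis 1 1) :: 'v \<Rightarrow>\<^sub>0 real^2"
  let ?B = "insert ?x (u ` E)"
  have "\<forall>y\<in>u ` E. cfg p (\<lambda>_. 1) y = 0" using u(1) represents_self by auto
  moreover have "cfg p (\<lambda>_. 1) ?x \<noteq> 0" using j0 by simp
  ultimately have B: "independent ?B" "?x \<notin> u ` E"
    using independent_insert_functional[OF u(3) linear_config_pairing] by auto
  have cardB: "card ?B = card E + 1" using B(2) finite_E card_image[OF u(2)] by simp
  have u_span: "u e \<in> span (unit_rows VP VL)" if "e \<in> E" for e
    using bspec[OF u(1) that] edge_space_subset[OF that, of VP VL] unfolding represents_def by auto
  then have "?B \<subseteq> span (unit_rows VP VL)" using single_line_in_span_unit_rows[OF j0] by auto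
  then have "card ?B \<le> card (unit_rows VP VL)"
    using independent_span_bound[OF finite_unit_rows[OF fin] B(1)] by simp
  moreover have "unit_rows VP VL \<subseteq> span ?B"
  proof
    fix y :: "'v \<Rightarrow>\<^sub>0 real^2" assume y: "y \<in> unit_rows VP VL"
    show "y \<in> span ?B"
    proof (rule ccontr)
      assume "y \<notin> span ?B"
      then have "\<exists>\<psi> :: ('v \<Rightarrow>\<^sub>0 real^2) \<Rightarrow> real.
          linear \<psi> \<and> (\<forall>z\<in>?B. \<psi> z = 0) \<and> (\<forall>x\<in>{y}. \<psi> x \<noteq> 0)"
        using B(1) by (intro functional_separating) auto
      then obtain \<psi> :: "('v \<Rightarrow>\<^sub>0 real^2) \<Rightarrow> real" where
        \<psi>: "linear \<psi>" "\<forall>z\<in>?B. \<psi> z = 0" "\<psi> y \<noteq> 0"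
        by auto
      obtain q \<sigma> where q: "\<forall>f\<in>span (unit_rows VP VL). \<psi> f = cfg q \<sigma> f"
        using functional_eq_config_pairing[OF \<psi>(1) fin disj] by (elim exE conjE)
      have ok: "edge_ok p q \<sigma> e" if "e \<in> E" for e
        using that \<psi>(2) bspec[OF q u_span[OF that]] bspec[OF u(1) that]
        unfolding represents_def by simp
      have "\<exists>t. (\<forall>i\<in>VP. q i = t *\<^sub>R p i) \<and> (\<forall>j\<in>VL. \<sigma> j = t)"
        using rigid ok unfolding rigid_iff[OF order_refl] by simp
      then obtain t where t: "\<forall>i\<in>VP. q i = t *\<^sub>R p i" "\<forall>j\<in>VL. \<sigma> j = t"
        by auto
      have "\<psi> ?x = cfg q \<sigma> ?x" using q single_line_in_span_unit_rows[OF j0] by simp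
      then have "t = 0" using \<psi>(2) t j0 by simp
      then have "cfg q \<sigma> y = 0" using t by (simp add: config_pairing_def)
      then show False using \<psi>(3) q y by (simp add: span_base)
    qed
  qed
  then have "card (unit_rows VP VL) \<le> card ?B"
    using independent_span_bound[of ?B "unit_rows VP VL"] finite_E independent_unit_rows by auto
  ultimately show ?thesis using cardB card_unit_rows[OF fin disj] by simp
qed

text \<open>In rotated coordinates the constant \<open>c\<close> is the translation by
  \<open>rot90 c\<close>. Orthogonality of \<open>c\<close> to \<open>b j\<close> means that points
  slide parallel to the line \<open>j\<close>, which stays fixed.\<close>

lemma translation_vanishes:
  assumes "represents p (\<lambda>_. 1) e w" and "\<And>j. j \<in> VL \<Longrightarrow> j \<in> e \<Longrightarrow> c \<bullet> b j = 0"
  shows "cfg (\<lambda>_. c) (\<lambda>_. 0) w = 0"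
proof -
  have "edge_ok p (\<lambda>_. c) (\<lambda>_. 0) e"
    using assms(2) by (auto simp: edge_ok_def inner_real2)
  then show ?thesis using assms(1) unfolding represents_def by simp
qed

text \<open>The unit rows at the incident vertices bound an independent set in their span by
  \<open>2 * card P + card L\<close>. The rows of \<open>F\<close> are enlarged inside this span by
  1, 2 or 3 vectors, for at least two lines, one line, or none.\<close>

lemma sparse_if_independent_rows:
  assumes u: "\<forall>e\<in>E. represents p (\<lambda>_. 1) e (u e)" "inj_on u E" "independent (u ` E)"
    and F: "F \<subseteq> E" "F \<noteq> {}"
  shows "sparse_count VP VL F"
proof -
  define P where "P = incident_vertices VP F"
  define L where "L = incident_vertices VL F"
  have PL_sub: "P \<subseteq> VP" "L \<subseteq> VL" unfolding P_def L_def incident_vertices_def by auto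
  have finPL: "finite P" "finite L" using PL_sub fin finite_subset by auto
  have disjPL: "P \<inter> L = {}" using PL_sub disj by auto
  have finF: "finite F" using F finite_E finite_subset by auto
  have FE: "e \<in> E" if "e \<in> F" for e using that F by auto
  have uF: "independent (u ` F)" "card (u ` F) = card F" "finite (u ` F)"
    using independent_mono[OF u(3) image_mono[OF F(1)]] card_image[OF inj_on_subset[OF u(2) F(1)]] finF
    by auto
  have rep: "represents p (\<lambda>_. 1) e (u e)" if "e \<in> F" for e using u(1) FE[OF that] by simp
  have in_PL: "i \<in> VP \<Longrightarrow> i \<in> P" "i \<in> VL \<Longrightarrow> i \<in> L" if "i \<in> e" "e \<in> F" for i e
    using that unfolding P_def L_def incident_vertices_def by auto
  have u_span: "u ` F \<subseteq> span (unit_rows P L)"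
  proof (rule image_subsetI)
    fix e assume e: "e \<in> F"
    have "edge_space e \<subseteq> span (unit_rows P L)"
      by (rule edge_space_subset[OF FE[OF e]]) (use in_PL e in auto)
    then show "u e \<in> span (unit_rows P L)" using rep[OF e] unfolding represents_def by auto
  qed
  have bound: "card B \<le> 2 * card P + card L" if "independent B" "B \<subseteq> span (unit_rows P L)" for B
    using independent_span_bound[OF finite_unit_rows[OF finPL] that] card_unit_rows[OF finPL disjPL]
    by simp
  have goal: "sparse_count VP VL F \<longleftrightarrow> int (card F) \<le> 2 * int (card P) + int (card L) - 3 + min 2 (int (card L))"
    unfolding sparse_count_def nu_def P_def L_def by simp
  let ?\<phi> = "cfg p (\<lambda>_. 1)"
  have \<phi>: "\<forall>y\<in>u ` F. ?\<phi> y = 0" using represents_self[OF FE rep] by auto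
  \<comment> \<open>The rows of \<open>F\<close> are annihilated by the dilation, and by the translations orthogonal to the
    directions \<open>b j\<close>, \<open>j \<in> L\<close>; each of these functionals yields one further independent row.\<close>
  consider "card L \<ge> 2" | "card L = 1" | "card L = 0" by linarith
  then show ?thesis
  proof cases
    case 1
    then have "L \<noteq> {}" by auto
    then obtain j where j: "j \<in> L" by auto
    let ?x = "Poly_Mapping.single j (axis 1 1) :: 'v \<Rightarrow>\<^sub>0 real^2"
    have "?\<phi> ?x \<noteq> 0" using j PL_sub by auto
    note x = independent_insert_functional[OF uF(1) linear_config_pairing \<phi> this]
    have "card (insert ?x (u ` F)) \<le> 2 * card P + card L"
      by (rule bound[OF x(1)]) (use u_span single_line_in_span_unit_rows[OF j] in auto)
    then show ?thesis using x(2) uF 1 unfolding goal by simp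
  next
    case 2
    then obtain j where L: "L = {j}" using card_1_singletonE by auto
    then have jVL: "j \<in> VL" using PL_sub by auto
    have "j \<in> L" using L by simp
    then obtain e where e: "e \<in> F" "j \<in> e" unfolding L_def incident_vertices_def by auto
    \<comment> \<open>A line-line edge would involve a second line, so the only line is joined to a
      point, on which the translation along the line can be evaluated.\<close>
    have "\<exists>i\<in>VP. i \<in> e"
      using FE[OF e(1)]
    proof (cases rule: edge_cases)
      case (LL i k)
      then have "i \<in> L" "k \<in> L" using in_PL(2)[OF _ e(1)] by auto
      then show ?thesis using L LL(3) by simp
    qed auto
    then obtain i where i: "i \<in> VP" "i \<in> P" using in_PL(1)[OF _ e(1)] by auto
    let ?x = "Poly_Mapping.single i (a j) :: 'v \<Rightarrow>\<^sub>0 real^2"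
    let ?y = "Poly_Mapping.single j (axis 1 1) :: 'v \<Rightarrow>\<^sub>0 real^2"
    let ?\<tau> = "cfg (\<lambda>_. a j) (\<lambda>_. 0)"
    \<comment> \<open>The rotation takes the value \<open>p i \<bullet> a j\<close> on
      \<open>?x\<close> and the translation takes the value 1. Subtracting this multiple gives a
      functional that also annihilates \<open>?x\<close>, while its value on \<open>?y\<close> is
      unaffected because translations do not move lines.\<close>
    let ?\<omega> = "\<lambda>f. ?\<phi> f - (p i \<bullet> a j) * ?\<tau> f"
    have "?\<tau> (u f) = 0" if f: "f \<in> F" for f
    proof (rule translation_vanishes[OF rep[OF f]])
      fix k assume "k \<in> VL" "k \<in> f"
      then have "k = j" using in_PL(2)[OF _ f] L by auto
      then show "a j \<bullet> b k = 0" by (simp add: inner_real2)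
    qed
    then have \<tau>: "\<forall>z\<in>u ` F. ?\<tau> z = 0" by auto
    have "?\<tau> ?x \<noteq> 0" using i inner_a[OF jVL] by simp
    note x = independent_insert_functional[OF uF(1) linear_config_pairing \<tau> this]
    have "linear ?\<omega>"
      using linear_compose_sub[OF linear_config_pairing[of VP VL p "\<lambda>_. 1"]
          linear_compose_scale_right[OF linear_config_pairing[of VP VL "\<lambda>_. a j" "\<lambda>_. 0"], of "p i \<bullet> a j"]]
      by simp
    moreover have "\<forall>z\<in>insert ?x (u ` F). ?\<omega> z = 0"
      using \<phi> \<tau> i inner_a[OF jVL] by simp
    moreover have "?\<omega> ?y \<noteq> 0" using jVL by simp
    ultimately have y: "independent (insert ?y (insert ?x (u ` F)))" "?y \<notin> insert ?x (u ` F)"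
      by (rule independent_insert_functional[OF x(1)])+
    have "card (insert ?y (insert ?x (u ` F))) \<le> 2 * card P + card L"
      by (rule bound[OF y(1)])
        (use u_span single_line_in_span_unit_rows[OF \<open>j \<in> L\<close>] single_point_in_span_unit_rows[OF i(2)] in auto)
    moreover have "card (insert ?y (insert ?x (u ` F))) = card F + 2"
      using x(2) y(2) uF by (simp del: insert_iff)
    ultimately show ?thesis using 2 unfolding goal by simp
  next
    case 3
    then have L: "L = {}" using finPL by simp
    obtain e where e: "e \<in> F" using F(2) by auto
    have "\<exists>i\<in>VP. \<exists>j\<in>VP. i \<noteq> j \<and> e = {i, j}"
      using FE[OF e]
    proof (cases rule: edge_cases)
      case (PL i k)
      then show ?thesis using in_PL(2)[OF _ e] L by auto
    next
      case (LL i k)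
      then show ?thesis using in_PL(2)[OF _ e] L by auto
    qed auto
    then obtain i j where ij: "i \<in> VP" "j \<in> VP" "i \<noteq> j" "e = {i, j}" by auto
    then have ijP: "i \<in> P" "j \<in> P" using in_PL(1)[OF _ e] by auto
    \<comment> \<open>For coinciding end points the constraint is void, so its row would pair to 0
      with every configuration and be zero, contrary to independence.\<close>
    have pij: "p j - p i \<noteq> 0"
    proof
      assume "p j - p i = 0"
      then have ok: "edge_ok p q \<sigma> e" for q \<sigma> using ij by (simp add: edge_ok_PP)
      obtain d where d: "u e = Poly_Mapping.single i d - Poly_Mapping.single j d"
        using rep[OF e] ij edge_space_PP unfolding represents_def by auto
      have "cfg (\<lambda>k. if k = i then d else 0) (\<lambda>_. 0) (u e) = 0"
        using rep[OF e] ok[of "\<lambda>k. if k = i then d else 0" "\<lambda>_. 0"] unfolding represents_def by simp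
      then have "d = 0" using ij unfolding d by simp
      then have "u e = 0" using d by simp
      then show False using uF(1) e dependent_zero[of "u ` F"] by (metis imageI)
    qed
    let ?x = "\<lambda>k :: 2. Poly_Mapping.single i (axis k 1) :: 'v \<Rightarrow>\<^sub>0 real^2"
    let ?y = "Poly_Mapping.single j (p j - p i)"
    let ?\<tau> = "\<lambda>c. cfg (\<lambda>_. c) (\<lambda>_. 0)"
    \<comment> \<open>The configuration \<open>p\<close> recentred at \<open>p i\<close>, that is,
      the rotation about this point. It annihilates both unit rows at \<open>i\<close>, and on
      \<open>?y\<close> it is the squared distance of the two end points.\<close>
    let ?\<omega> = "\<lambda>f. ?\<phi> f - ?\<tau> (p i) f"
    have "?\<tau> c (u f) = 0" if f: "f \<in> F" for c f
      by (rule translation_vanishes[OF rep[OF f]]) (use in_PL(2)[OF _ f] L in auto)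
    then have \<tau>: "\<forall>z\<in>u ` F. ?\<tau> c z = 0" for c by auto
    have "?\<tau> (axis 1 1) (?x 1) \<noteq> 0" using ij by (simp add: inner_real2 axis_def)
    note x1 = independent_insert_functional[OF uF(1) linear_config_pairing \<tau> this]
    have "?\<tau> (axis 2 1) (?x 2) \<noteq> 0" using ij by (simp add: inner_real2 axis_def)
    moreover have "\<forall>z\<in>insert (?x 1) (u ` F). ?\<tau> (axis 2 1) z = 0"
      using \<tau> ij by (simp add: inner_real2 axis_def)
    ultimately have x2: "independent (insert (?x 2) (insert (?x 1) (u ` F)))"
      "?x 2 \<notin> insert (?x 1) (u ` F)"
      using independent_insert_functional[OF x1(1) linear_config_pairing] by auto
    have "linear ?\<omega>" by (intro linear_compose_sub linear_config_pairing)
    moreover have "\<forall>z\<in>insert (?x 2) (insert (?x 1) (u ` F)). ?\<omega> z = 0" using \<phi> \<tau> ij by simp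
    moreover have "?\<omega> ?y = (p j - p i) \<bullet> (p j - p i)" using ij by (simp add: inner_diff_left)
    then have "?\<omega> ?y \<noteq> 0" using pij by simp
    ultimately have y: "independent (insert ?y (insert (?x 2) (insert (?x 1) (u ` F))))"
      "?y \<notin> insert (?x 2) (insert (?x 1) (u ` F))"
      by (rule independent_insert_functional[OF x2(1)])+
    have "card (insert ?y (insert (?x 2) (insert (?x 1) (u ` F)))) \<le> 2 * card P + card L"
      by (rule bound[OF y(1)])
        (use u_span single_point_in_span_unit_rows[OF ijP(1)] single_point_in_span_unit_rows[OF ijP(2)] in auto)
    moreover have "card (insert ?y (insert (?x 2) (insert (?x 1) (u ` F)))) = card F + 3"
      using x1(2) x2(2) y(2) uF by (simp del: insert_iff)
    ultimately show ?thesis using 3 unfolding goal by simp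
  qed
qed

end

theorem theorem4p3:
  fixes VP VL :: "'v set" and E :: "'v set set" and a :: "'v \<Rightarrow> real^2"
  assumes "point_line_graph VP VL E"
    and "card VL \<ge> 2"
    and "\<And>j. j \<in> VL \<Longrightarrow> a j \<in> sphere 0 1"
    and "inj_on (\<lambda>j. origin_line (a j)) VL"
  shows "(\<exists>p :: 'v \<Rightarrow> real^2. line_concurrent_framework VP VL E p a \<and>
             min_inf_fixed_intercept_rigid VP VL E p a) \<longleftrightarrow>
         int (card E) = 2 * int (card VP) + int (card VL) - 1 \<and>
         (\<forall>F. F \<subseteq> E \<and> F \<noteq> {} \<longrightarrow>
            int (card F) \<le> 2 * int (nu VP F) + int (nu VL F) - 3
                             + min 2 (int (card (incident_vertices VL F))))"
    (is "?realisable \<longleftrightarrow> ?count \<and> ?sparse")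
proof -
  have norm_a: "norm (a j) = 1" if "j \<in> VL" for j using assms(3)[OF that] by simp
  interpret concurrent_lines VP VL E a
    using assms(1,4) norm_a by unfold_locales
  have framework: "line_concurrent_framework VP VL E p a" for p
    using assms(1) norm_a unfolding line_concurrent_framework_def by simp
  have "VL \<noteq> {}" using assms(2) by auto
  then obtain j0 where j0: "j0 \<in> VL" by auto
  have count: "?count \<longleftrightarrow> card E + 1 = 2 * card VP + card VL" by linarith
  have sparse: "?sparse \<longleftrightarrow> (\<forall>F. F \<subseteq> E \<and> F \<noteq> {} \<longrightarrow> sparse_count VP VL F)"
    unfolding sparse_count_def ..
  show ?thesis
  proof
    assume ?realisable
    then obtain p where p: "min_inf_fixed_intercept_rigid VP VL E p a" by auto
    obtain u where u: "\<forall>e\<in>E. represents p (\<lambda>_. 1) e (u e)" "inj_on u E" "independent (u ` E)"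
      using independent_rows_if_min_rigid[OF p] by (elim exE conjE)
    have "inf_fixed_intercept_rigid VP VL E p a"
      using p unfolding min_inf_fixed_intercept_rigid_def by simp
    from card_if_rigid[OF this j0 u] sparse_if_independent_rows[OF u]
    show "?count \<and> ?sparse" unfolding count sparse by simp
  next
    assume cs: "?count \<and> ?sparse"
    then have sp: "sparse_count VP VL F" if "F \<subseteq> E" "F \<noteq> {}" for F
      using that unfolding sparse by simp
    have "rank_ge (card F + 1) (\<Union>(edge_space ` F))" if "F \<subseteq> E" "F \<noteq> {}" for F
      by (rule rank_edge_spaces[OF that]) (use that sp in auto)
    then show ?realisable
      using realisation_if_rank[OF _ \<open>VL \<noteq> {}\<close>] cs framework unfolding count by auto
  qed
qed

end
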